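(* Consider the problem of minimizing $J(x(\cdot))=\int_{t_0}^{t_1}L(t,x(t),\dot x(t))\,dt$ over $x(\cdot)\in KC^1(I,\mathbb R^n)$ with $x(t_0)=x_0$, $x(t_1)=x_1$. Let $L$ and $L_x$ be continuously differentiable in the totality of variables, let the admissible function $\bar x(\cdot)$ be an extremal of this problem, and let $(\bar t_0,\bar t_1)\subset[t_0,t_1]$ be an interval on which $\bar x(\cdot)$ is twice continuously differentiable. For $\eta\in\mathbb R^n$ and $\bar\lambda\in(0,1)$ consider the degeneration condition $$E(\bar L)(t,\eta)=E(\bar L)\big(t,(\bar\lambda-1)^{-1}\bar\lambda\eta\big)=0\quad\text{for all }t\in(\bar t_0,\bar t_1)\qquad(\mathrm D)$$ and the inequality $$\eta^T\Big(\bar\lambda\bar L_{xx}(t,\eta)+(1-\bar\lambda)\bar L_{xx}\big(t,(\bar\lambda-1)^{-1}\bar\lambda\eta\big)\Big)\eta-\frac{d}{dt}\Delta\bar L_x^T(t,\eta)\eta\ge0\quad\text{for all }t\in(\bar t_0,\bar t_1).\qquad(\mathrm C)$$ Then: (i) If $\bar x(\cdot)$ is a strong local minimum in the problem and (D) holds for a vector $\eta\ne0$ and a number $\bar\lambda\in(0,1)$, then (C) holds for these $\eta,\bar\lambda$. (ii) If $\bar x(\cdot)$ is a weak local minimum in the problem, then there exists a number $\delta>0$ such that for every point $\big(\eta,(\bar\lambda-1)^{-1}\bar\lambda\eta,\bar\lambda\big)\in B_\delta(0)\times B_\delta(0)\times(0,1)$ satisfying (D), inequality (C) is fulfilled.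
   Context: Setting. $(a,b)\subset\mathbb R$ is an interval, $I:=[t_0,t_1]\subset(a,b)$ with $t_0<t_1$, $x_0,x_1\in\mathbb R^n$, and $L=L(t,x,\dot x):(a,b)\times\mathbb R^n\times\mathbb R^n\to\mathbb R$; $L_x,L_{\dot x}$ are its partial gradients (column vectors) with respect to the second and third arguments, $L_{xx}$ the Hessian in the second argument; $T$ denotes transposition; $B_\delta(0)$ is the closed ball of radius $\delta$ centered at $0\in\mathbb R^n$. $KC^1(I,\mathbb R^n)$ is the set of piecewise-smooth functions: continuous functions $x:I\to\mathbb R^n$ whose derivative is continuous on $I$ except at finitely many points of $(t_0,t_1)$ (angular points), where $\dot x$ has discontinuities of the first kind (finite one-sided limits); at $t_0$ and $t_1$ the right, respectively left, values of $\dot x$ are finite. A function $x(\cdot)\in KC^1(I,\mathbb R^n)$ with $x(t_0)=x_0$, $x(t_1)=x_1$ is called admissible. An admissible $\bar x(\cdot)$ is an extremal if it satisfies the Euler equation $\frac{d}{dt}L_{\dot x}(t,\bar x(t),\dot{\bar x}(t))=L_x(t,\bar x(t),\dot{\bar x}(t))$ at every $t\in I$ that is not an angular point of $\bar x$ (at $t_0$ and $t_1$ understood one-sidedly). An admissible $\bar x(\cdot)$ is a strong (weak) local minimum if there is $\bar\delta>0$ ($\hat\delta>0$) such that $J(x(\cdot))\ge J(\bar x(\cdot))$ for all admissible $x(\cdot)$ with $\|x(\cdot)-\bar x(\cdot)\|_{C(I,\mathbb R^n)}\le\bar\delta$ (respectively $\max\{\|x(\cdot)-\bar x(\cdot)\|_{C(I,\mathbb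 R^n)},\|\dot x(\cdot)-\dot{\bar x}(\cdot)\|_{L_\infty(I,\mathbb R^n)}\}\le\hat\delta$). Notation along $\bar x(\cdot)$, for $\xi\in\mathbb R^n$: $\bar L(t)=L(t,\bar x(t),\dot{\bar x}(t))$, $\bar L_x(t)=L_x(t,\bar x(t),\dot{\bar x}(t))$, $\bar L_{\dot x}(t)=L_{\dot x}(t,\bar x(t),\dot{\bar x}(t))$, $\bar L_{xx}(t,\xi)=L_{xx}(t,\bar x(t),\dot{\bar x}(t)+\xi)$, $$E(\bar L)(t,\xi)=L(t,\bar x(t),\dot{\bar x}(t)+\xi)-\bar L(t)-\bar L_{\dot x}^T(t)\xi,\qquad \Delta\bar L_x(t,\xi)=L_x(t,\bar x(t),\dot{\bar x}(t)+\xi)-\bar L_x(t).$$ *)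

theory Defs
  imports "HOL-Analysis.Analysis" "HOL-Probability.Essential_Supremum"
begin

text \<open>
  A curve on \<open>I = [t0, t1]\<close> is a function \<open>x :: real \<Rightarrow> real^'n\<close>, of which only the values on
  \<open>{t0..t1}\<close> matter: all derivatives of curves are taken \<^emph>\<open>within\<close> \<open>{t0..t1}\<close>, hence are
  two-sided inside and one-sided at \<open>t0\<close> and \<open>t1\<close>.  A Lagrangian \<open>L t x v\<close> is a total function,
  of which only the values for \<open>t\<close> in the open interval \<open>(a, b)\<close> matter.
\<close>

subsection \<open>Differential calculus in several variables\<close>

definition gradient :: "('a::real_inner \<Rightarrow> real) \<Rightarrow> 'a \<Rightarrow> 'a" where
  "gradient f x = (THE D. GDERIV f x :> D)"

text \<open>Continuous differentiability, meant for open \<open>S\<close>; the derivative is continuous for the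
  operator norm.\<close>

definition C1_on :: "('a::real_normed_vector \<Rightarrow> 'b::real_normed_vector) \<Rightarrow> 'a set \<Rightarrow> bool" where
  "C1_on f S \<longleftrightarrow>
     (\<exists>f' :: 'a \<Rightarrow> 'a \<Rightarrow>\<^sub>L 'b.
        (\<forall>p\<in>S. (f has_derivative blinfun_apply (f' p)) (at p)) \<and> continuous_on S f')"

type_synonym 'n lagrangian = "real \<Rightarrow> real^'n \<Rightarrow> real^'n \<Rightarrow> real"

definition grad_x :: "('n::finite) lagrangian \<Rightarrow> real \<Rightarrow> real^'n \<Rightarrow> real^'n \<Rightarrow> real^'n" where
  "grad_x L t x v = gradient (\<lambda>y. L t y v) x"

definition grad_v :: "('n::finite) lagrangian \<Rightarrow> real \<Rightarrow> real^'n \<Rightarrow> real^'n \<Rightarrow> real^'n" where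
  "grad_v L t x v = gradient (\<lambda>w. L t x w) v"

definition hess_xx :: "('n::finite) lagrangian \<Rightarrow> real \<Rightarrow> real^'n \<Rightarrow> real^'n \<Rightarrow> real^'n^'n" where
  "hess_xx L t x v = jacobian (\<lambda>y. grad_x L t y v) (at x)"

subsection \<open>Piecewise smooth functions\<close>

definition xdot :: "real \<Rightarrow> real \<Rightarrow> (real \<Rightarrow> real^'n) \<Rightarrow> real \<Rightarrow> real^('n::finite)" where
  "xdot t0 t1 x t = vector_derivative x (at t within {t0..t1})"

text \<open>The points of \<open>I\<close> at which the derivative does not exist or is not continuous.  The value of
  \<^const>\<open>xdot\<close> at a point of non-differentiability is arbitrary; such points are finitely many for
  the functions considered.\<close>

definition angular_points ::
    "real \<Rightarrow> real \<Rightarrow> (real \<Rightarrow> real^'n) \<Rightarrow> real set" where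
  "angular_points t0 t1 (x :: real \<Rightarrow> real^('n::finite)) =
     {t \<in> {t0..t1}. \<not> (x differentiable (at t within {t0..t1}) \<and>
                     continuous (at t within {t0..t1}) (xdot t0 t1 x))}"

definition KC1 :: "real \<Rightarrow> real \<Rightarrow> (real \<Rightarrow> real^('n::finite)) set" where
  "KC1 t0 t1 =
     {x. continuous_on {t0..t1} x \<and>
         finite (angular_points t0 t1 x) \<and>
         angular_points t0 t1 x \<subseteq> {t0<..<t1} \<and>
         (\<forall>s\<in>angular_points t0 t1 x.
            (\<exists>l. (xdot t0 t1 x \<longlongrightarrow> l) (at_left s)) \<and>
            (\<exists>r. (xdot t0 t1 x \<longlongrightarrow> r) (at_right s)))}"

definition C_norm :: "real \<Rightarrow> real \<Rightarrow> (real \<Rightarrow> real^('n::finite)) \<Rightarrow> real" where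
  "C_norm t0 t1 x = (SUP t\<in>{t0..t1}. norm (x t))"

definition Linf_norm :: "real \<Rightarrow> real \<Rightarrow> (real \<Rightarrow> real^('n::finite)) \<Rightarrow> ereal" where
  "Linf_norm t0 t1 y = esssup (lebesgue_on {t0..t1}) (\<lambda>t. ereal (norm (y t)))"

subsection \<open>The variational problem\<close>

definition J :: "('n::finite) lagrangian \<Rightarrow> real \<Rightarrow> real \<Rightarrow> (real \<Rightarrow> real^'n) \<Rightarrow> real" where
  "J L t0 t1 x = integral {t0..t1} (\<lambda>t. L t (x t) (xdot t0 t1 x t))"

definition admissible ::
    "real \<Rightarrow> real \<Rightarrow> real^'n \<Rightarrow> real^'n \<Rightarrow> (real \<Rightarrow> real^('n::finite)) \<Rightarrow> bool" where
  "admissible t0 t1 x0 x1 x \<longleftrightarrow> x \<in> KC1 t0 t1 \<and> x t0 = x0 \<and> x t1 = x1"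

definition extremal ::
    "('n::finite) lagrangian \<Rightarrow> real \<Rightarrow> real \<Rightarrow> real^'n \<Rightarrow> real^'n \<Rightarrow> (real \<Rightarrow> real^'n) \<Rightarrow> bool" where
  "extremal L t0 t1 x0 x1 x \<longleftrightarrow>
     admissible t0 t1 x0 x1 x \<and>
     (\<forall>t \<in> {t0..t1} - angular_points t0 t1 x.
        ((\<lambda>s. grad_v L s (x s) (xdot t0 t1 x s))
           has_vector_derivative grad_x L t (x t) (xdot t0 t1 x t)) (at t within {t0..t1}))"

definition strong_local_min ::
    "('n::finite) lagrangian \<Rightarrow> real \<Rightarrow> real \<Rightarrow> real^'n \<Rightarrow> real^'n \<Rightarrow> (real \<Rightarrow> real^'n) \<Rightarrow> bool" where
  "strong_local_min L t0 t1 x0 x1 xb \<longleftrightarrow>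
     admissible t0 t1 x0 x1 xb \<and>
     (\<exists>\<delta>>0. \<forall>x. admissible t0 t1 x0 x1 x \<and> C_norm t0 t1 (\<lambda>t. x t - xb t) \<le> \<delta>
        \<longrightarrow> J L t0 t1 x \<ge> J L t0 t1 xb)"

definition weak_local_min ::
    "('n::finite) lagrangian \<Rightarrow> real \<Rightarrow> real \<Rightarrow> real^'n \<Rightarrow> real^'n \<Rightarrow> (real \<Rightarrow> real^'n) \<Rightarrow> bool" where
  "weak_local_min L t0 t1 x0 x1 xb \<longleftrightarrow>
     admissible t0 t1 x0 x1 xb \<and>
     (\<exists>\<delta>>0. \<forall>x. admissible t0 t1 x0 x1 x \<and>
          max (ereal (C_norm t0 t1 (\<lambda>t. x t - xb t)))
              (Linf_norm t0 t1 (\<lambda>t. xdot t0 t1 x t - xdot t0 t1 xb t)) \<le> ereal \<delta>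
        \<longrightarrow> J L t0 t1 x \<ge> J L t0 t1 xb)"

subsection \<open>Quantities along a curve\<close>

definition excess ::
    "('n::finite) lagrangian \<Rightarrow> real \<Rightarrow> real \<Rightarrow> (real \<Rightarrow> real^'n) \<Rightarrow> real \<Rightarrow> real^'n \<Rightarrow> real" where
  "excess L t0 t1 xb t \<xi> =
     L t (xb t) (xdot t0 t1 xb t + \<xi>) - L t (xb t) (xdot t0 t1 xb t)
       - grad_v L t (xb t) (xdot t0 t1 xb t) \<bullet> \<xi>"

definition Lxx_bar ::
    "('n::finite) lagrangian \<Rightarrow> real \<Rightarrow> real \<Rightarrow> (real \<Rightarrow> real^'n) \<Rightarrow> real \<Rightarrow> real^'n \<Rightarrow> real^'n^'n" where
  "Lxx_bar L t0 t1 xb t \<xi> = hess_xx L t (xb t) (xdot t0 t1 xb t + \<xi>)"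

definition Delta_Lx ::
    "('n::finite) lagrangian \<Rightarrow> real \<Rightarrow> real \<Rightarrow> (real \<Rightarrow> real^'n) \<Rightarrow> real \<Rightarrow> real^'n \<Rightarrow> real^'n" where
  "Delta_Lx L t0 t1 xb t \<xi> =
     grad_x L t (xb t) (xdot t0 t1 xb t + \<xi>) - grad_x L t (xb t) (xdot t0 t1 xb t)"

text \<open>In the next two conditions \<open>l\<close> is the number usually written \<open>\<lambda>\<close>, and \<open>{s0<..<s1}\<close> is the
  subinterval on which the curve is smooth.\<close>

definition degeneration ::
    "('n::finite) lagrangian \<Rightarrow> real \<Rightarrow> real \<Rightarrow> (real \<Rightarrow> real^'n) \<Rightarrow> real \<Rightarrow> real
       \<Rightarrow> real^'n \<Rightarrow> real \<Rightarrow> bool" where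
  "degeneration L t0 t1 xb s0 s1 \<eta> l \<longleftrightarrow>
     (\<forall>t\<in>{s0<..<s1}. excess L t0 t1 xb t \<eta> = 0 \<and>
                     excess L t0 t1 xb t ((inverse (l - 1) * l) *\<^sub>R \<eta>) = 0)"

definition condition_C ::
    "('n::finite) lagrangian \<Rightarrow> real \<Rightarrow> real \<Rightarrow> (real \<Rightarrow> real^'n) \<Rightarrow> real \<Rightarrow> real
       \<Rightarrow> real^'n \<Rightarrow> real \<Rightarrow> bool" where
  "condition_C L t0 t1 xb s0 s1 \<eta> l \<longleftrightarrow>
     (\<forall>t\<in>{s0<..<s1}.
        \<eta> \<bullet> ((l *\<^sub>R Lxx_bar L t0 t1 xb t \<eta> +
              (1 - l) *\<^sub>R Lxx_bar L t0 t1 xb t ((inverse (l - 1) * l) *\<^sub>R \<eta>)) *v \<eta>)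
          - vector_derivative (\<lambda>s. Delta_Lx L t0 t1 xb s \<eta>) (at t) \<bullet> \<eta> \<ge> 0)"

end

theory Submission
  imports Defs
begin

text \<open>
  Perturb the extremal by a tooth in direction \<open>\<eta>\<close> starting at a point \<open>c\<close> of the smooth arc: slope \<open>\<eta>\<close>
  on an interval of length \<open>l * h\<close>, then slope \<open>\<xi> = l / (l - 1) *\<^sub>R \<eta>\<close> on one of length \<open>(1 - l) * h\<close>.
  By the Euler equation the terms linear in the perturbation and its velocity integrate to zero,
  and by degeneration the zeroth-order terms vanish.  The increment of \<open>J\<close> therefore equals
  \<open>p * h\<^sup>2 + q * h\<^sup>3 + o(h\<^sup>3)\<close> with
  \<open>p = l / 2 * (l * \<Delta>L\<^sub>x(c, \<eta>) \<bullet> \<eta> + (1 - l) * \<Delta>L\<^sub>x(c, \<xi>) \<bullet> \<eta>)\<close>.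
  Minimality gives \<open>p \<ge> 0\<close>, and \<open>p \<le> 0\<close> comes from the tooth with the two slopes exchanged.
  So \<open>p\<close> vanishes along the arc, \<open>q \<ge> 0\<close>, and differentiating \<open>p = 0\<close> turns \<open>q\<close> into
  \<open>l\<^sup>2 / 6\<close> times the left-hand side of condition (C).
\<close>

subsection \<open>Piecewise smooth functions\<close>

text \<open>A finite subcover patches the local bounds together. The filter
  \<open>at t within S\<close> says nothing about the value at \<open>t\<close> itself, so each
  local bound is enlarged by \<open>norm (f t)\<close>; this matters for derivatives whose value at
  a corner is arbitrary.\<close>

lemma bounded_image_if_locally_bounded:
  fixes f :: "'a::metric_space \<Rightarrow> 'b::real_normed_vector"
  assumes "compact S"
    and loc: "\<And>t. t \<in> S \<Longrightarrow> \<exists>B. \<forall>\<^sub>F s in at t within S. norm (f s) \<le> B"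
  shows "bounded (f ` S)"
proof -
  have "\<exists>U. open U \<and> t \<in> U \<and> bounded (f ` (U \<inter> S))" if "t \<in> S" for t
  proof -
    obtain B where "\<forall>\<^sub>F s in at t within S. norm (f s) \<le> B" using loc[OF \<open>t \<in> S\<close>] by blast
    then obtain U where U: "open U" "t \<in> U" "\<forall>s\<in>U. s \<noteq> t \<longrightarrow> s \<in> S \<longrightarrow> norm (f s) \<le> B"
      unfolding eventually_at_topological by blast
    have "norm (f s) \<le> max B (norm (f t))" if "s \<in> U \<inter> S" for s
      using U(3) that by (cases "s = t") (auto simp: le_max_iff_disj)
    then have "bounded (f ` (U \<inter> S))" unfolding bounded_iff by auto
    then show ?thesis using U by auto
  qed
  then obtain U where U: "\<And>t. t \<in> S \<Longrightarrow> open (U t) \<and> t \<in> U t \<and> bounded (f ` (U t \<inter> S))"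
    by metis
  have "S \<subseteq> (\<Union>t\<in>S. U t)" using U by auto
  then obtain T where T: "T \<subseteq> S" "finite T" "S \<subseteq> (\<Union>t\<in>T. U t)"
    using compactE_image[OF assms(1), of S U] U by metis
  have "bounded (\<Union>t\<in>T. f ` (U t \<inter> S))" using T U by (intro bounded_UN) auto
  moreover have "f ` S \<subseteq> (\<Union>t\<in>T. f ` (U t \<inter> S))" using T by blast
  ultimately show ?thesis using bounded_subset by blast
qed

text \<open>Off the null set \<open>N\<close> the function is measurable and dominated by a
  constant; restoring finitely many points does not affect integrability.\<close>

lemma integrable_bounded_continuous_off_finite:
  fixes f :: "real \<Rightarrow> 'b::euclidean_space"
  assumes "bounded (f ` {a..b})" "finite N" "continuous_on ({a..b} - N) f"
  shows "f integrable_on {a..b}"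
proof -
  obtain B where B: "\<And>t. t \<in> {a..b} \<Longrightarrow> norm (f t) \<le> B"
    using assms(1) unfolding bounded_iff by blast
  have neg: "negligible N" using assms(2) by (rule negligible_finite)
  have sets: "{a..b} - N \<in> sets lebesgue"
    using neg by (intro sets.Diff) (auto intro: negligible_imp_sets)
  have "f integrable_on ({a..b} - N)"
  proof (rule measurable_bounded_by_integrable_imp_integrable[where g = "\<lambda>_. B"])
    show "f \<in> borel_measurable (lebesgue_on ({a..b} - N))"
      using continuous_imp_measurable_on_sets_lebesgue[OF assms(3) sets] .
    show "(\<lambda>_. B) integrable_on {a..b} - N"
      by (rule integrable_spike_set[of _ "{a..b}"]) (auto intro: negligible_subset[OF neg])
  qed (use B sets in auto)
  then show ?thesis
    by (rule integrable_spike_set) (auto intro: negligible_subset[OF neg])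
qed

text \<open>The set \<open>N\<close> of suspected corners may exceed the set of angular points,
  since one-sided slopes may happen to agree. Around every point of \<open>I\<close> there is a
  punctured neighbourhood in which \<open>y\<close> and \<open>xdot\<close> coincide, so limits
  transfer from one to the other.\<close>

lemma KC1I:
  fixes x y :: "real \<Rightarrow> real^'n::finite"
  assumes "t0 < t1" and N: "finite N" "N \<subseteq> {t0<..<t1}"
    and cont: "continuous_on {t0..t1} x"
    and der: "\<And>t. t \<in> {t0..t1} - N \<Longrightarrow> (x has_vector_derivative y t) (at t within {t0..t1})"
    and ycont: "\<And>t. t \<in> {t0..t1} - N \<Longrightarrow> continuous (at t within {t0..t1}) y"
    and left: "\<And>s. s \<in> N \<Longrightarrow> \<exists>l. (y \<longlongrightarrow> l) (at_left s)"
    and right: "\<And>s. s \<in> N \<Longrightarrow> \<exists>r. (y \<longlongrightarrow> r) (at_right s)"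
  shows "x \<in> KC1 t0 t1" and "angular_points t0 t1 x \<subseteq> N"
    and "\<And>t. t \<in> {t0..t1} - N \<Longrightarrow> xdot t0 t1 x t = y t"
proof -
  show eq: "xdot t0 t1 x t = y t" if "t \<in> {t0..t1} - N" for t
    unfolding xdot_def using vector_derivative_within_cbox[of t0 t1 t x] der[OF that] that \<open>t0 < t1\<close>
    by simp
  have opn: "open (- N)" using N by (simp add: finite_imp_closed open_Compl)
  show ang: "angular_points t0 t1 x \<subseteq> N"
  proof
    fix t assume t: "t \<in> angular_points t0 t1 x"
    show "t \<in> N"
    proof (rule ccontr)
      assume "t \<notin> N"
      then have tN: "t \<in> {t0..t1} - N" using t by (auto simp: angular_points_def)
      have "\<forall>\<^sub>F s in at t within {t0..t1}. y s = xdot t0 t1 x s"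
        unfolding eventually_at_topological using opn tN eq by (intro exI[of _ "- N"]) auto
      moreover have "(y \<longlongrightarrow> xdot t0 t1 x t) (at t within {t0..t1})"
        using ycont[OF tN] eq[OF tN] by (simp add: continuous_within)
      ultimately have "(xdot t0 t1 x \<longlongrightarrow> xdot t0 t1 x t) (at t within {t0..t1})"
        by (rule Lim_transform_eventually[rotated])
      then show False using t der[OF tN]
        by (auto simp: angular_points_def continuous_within
            intro: differentiableI_vector)
    qed
  qed
  have ev: "\<forall>\<^sub>F r in at s. y r = xdot t0 t1 x r" if "s \<in> N" for s
  proof -
    have "open ({t0<..<t1} - (N - {s}))" using N by (intro open_Diff finite_imp_closed) auto
    moreover have "s \<in> {t0<..<t1} - (N - {s})" using that N by auto
    moreover have "\<forall>r\<in>{t0<..<t1} - (N - {s}). r \<noteq> s \<longrightarrow> y r = xdot t0 t1 x r"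
    proof (intro ballI impI)
      fix r assume "r \<in> {t0<..<t1} - (N - {s})" "r \<noteq> s"
      then have "r \<in> {t0..t1} - N" by simp
      then show "y r = xdot t0 t1 x r" using eq by simp
    qed
    ultimately show ?thesis unfolding eventually_at_topological by blast
  qed
  have lims: "(\<exists>l. (xdot t0 t1 x \<longlongrightarrow> l) (at_left s)) \<and> (\<exists>r. (xdot t0 t1 x \<longlongrightarrow> r) (at_right s))"
    if "s \<in> N" for s
  proof -
    have "\<forall>\<^sub>F r in at_left s. y r = xdot t0 t1 x r" "\<forall>\<^sub>F r in at_right s. y r = xdot t0 t1 x r"
      using ev[OF that] by (auto simp: eventually_at_split)
    then show ?thesis
      using left[OF that] right[OF that] by (blast intro: Lim_transform_eventually)
  qed
  show "x \<in> KC1 t0 t1"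
    unfolding KC1_def using cont N ang lims finite_subset[OF ang N(1)] by blast
qed

lemma KC1_finite_angular: "x \<in> KC1 t0 t1 \<Longrightarrow> finite (angular_points t0 t1 x)"
  by (simp add: KC1_def)

lemma KC1_angular_interior: "x \<in> KC1 t0 t1 \<Longrightarrow> angular_points t0 t1 x \<subseteq> {t0<..<t1}"
  by (simp add: KC1_def)

lemma xdot_continuous_off_angular:
  "t \<in> {t0..t1} - angular_points t0 t1 x \<Longrightarrow> continuous (at t within {t0..t1}) (xdot t0 t1 x)"
  by (simp add: angular_points_def)

lemma has_vector_derivative_xdot:
  "t \<in> {t0..t1} - angular_points t0 t1 x \<Longrightarrow>
     (x has_vector_derivative xdot t0 t1 x t) (at t within {t0..t1})"
  by (simp add: angular_points_def xdot_def vector_derivative_works)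

text \<open>Needed at smooth points too: a corner of a sum may be a smooth point of one summand,
  where continuity supplies both limits.\<close>

lemma KC1_one_sided_limits:
  assumes "x \<in> KC1 t0 t1" "s \<in> {t0<..<t1}"
  shows "\<exists>l. (xdot t0 t1 x \<longlongrightarrow> l) (at_left s)" "\<exists>r. (xdot t0 t1 x \<longlongrightarrow> r) (at_right s)"
proof -
  have "(\<exists>l. (xdot t0 t1 x \<longlongrightarrow> l) (at_left s)) \<and> (\<exists>r. (xdot t0 t1 x \<longlongrightarrow> r) (at_right s))"
  proof (cases "s \<in> angular_points t0 t1 x")
    case False
    then have "continuous (at s within {t0..t1}) (xdot t0 t1 x)"
      using assms by (intro xdot_continuous_off_angular) auto
    moreover have "at s within {t0..t1} = at s"
      using assms(2) by (intro at_within_interior) auto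
    ultimately have "(xdot t0 t1 x \<longlongrightarrow> xdot t0 t1 x s) (at s)"
      by (simp add: continuous_within)
    then show ?thesis using filterlim_at_split by blast
  qed (use assms in \<open>auto simp: KC1_def\<close>)
  then show "\<exists>l. (xdot t0 t1 x \<longlongrightarrow> l) (at_left s)" "\<exists>r. (xdot t0 t1 x \<longlongrightarrow> r) (at_right s)"
    by auto
qed

text \<open>Corners of the summands may cancel, hence the union of both angular sets serves as the
  exceptional set in \<open>KC1I\<close>.\<close>

lemma KC1_add:
  assumes "t0 < t1" "x \<in> KC1 t0 t1" "y \<in> KC1 t0 t1"
  shows "(\<lambda>t. x t + y t) \<in> KC1 t0 t1"
    and "\<And>t. t \<in> {t0..t1} - (angular_points t0 t1 x \<union> angular_points t0 t1 y) \<Longrightarrow>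
           xdot t0 t1 (\<lambda>t. x t + y t) t = xdot t0 t1 x t + xdot t0 t1 y t"
proof -
  let ?N = "angular_points t0 t1 x \<union> angular_points t0 t1 y"
  let ?y = "\<lambda>t. xdot t0 t1 x t + xdot t0 t1 y t"
  have "finite ?N" and N: "?N \<subseteq> {t0<..<t1}" and "continuous_on {t0..t1} (\<lambda>t. x t + y t)"
    using assms by (auto simp: KC1_def intro: continuous_intros)
  moreover have "((\<lambda>t. x t + y t) has_vector_derivative ?y t) (at t within {t0..t1})"
      "continuous (at t within {t0..t1}) ?y" if "t \<in> {t0..t1} - ?N" for t
    using that by (auto intro!: has_vector_derivative_add has_vector_derivative_xdot
        continuous_add xdot_continuous_off_angular)
  moreover have "\<exists>l. (?y \<longlongrightarrow> l) (at_left s)" "\<exists>r. (?y \<longlongrightarrow> r) (at_right s)" if "s \<in> ?N" for s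
  proof -
    have s: "s \<in> {t0<..<t1}" using that N by auto
    show "\<exists>l. (?y \<longlongrightarrow> l) (at_left s)" "\<exists>r. (?y \<longlongrightarrow> r) (at_right s)"
      using KC1_one_sided_limits[OF assms(2) s] KC1_one_sided_limits[OF assms(3) s]
      by (metis tendsto_add)+
  qed
  ultimately show "(\<lambda>t. x t + y t) \<in> KC1 t0 t1"
    and "\<And>t. t \<in> {t0..t1} - ?N \<Longrightarrow> xdot t0 t1 (\<lambda>t. x t + y t) t = ?y t"
    using KC1I[OF assms(1), of ?N "\<lambda>t. x t + y t" ?y] by blast+
qed

lemma bounded_xdot:
  assumes "x \<in> KC1 t0 t1"
  shows "bounded (xdot t0 t1 x ` {t0..t1})"
proof (rule bounded_image_if_locally_bounded)
  fix t assume t: "t \<in> {t0..t1}"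
  have bd: "\<exists>B. \<forall>\<^sub>F s in F. norm (f s) \<le> B" if "(f \<longlongrightarrow> l) F"
    for f :: "real \<Rightarrow> real^'a" and l F
  proof -
    have "\<forall>\<^sub>F s in F. norm (f s) < norm l + 1"
      using order_tendstoD(2)[OF tendsto_norm[OF that]] by simp
    then show ?thesis by (intro exI[of _ "norm l + 1"]) (auto elim: eventually_mono)
  qed
  show "\<exists>B. \<forall>\<^sub>F s in at t within {t0..t1}. norm (xdot t0 t1 x s) \<le> B"
  proof (cases "t \<in> angular_points t0 t1 x")
    case False
    then show ?thesis using xdot_continuous_off_angular[of t t0 t1 x] t bd
      by (auto simp: continuous_within)
  next
    case True
    then have ti: "t \<in> {t0<..<t1}" using KC1_angular_interior[OF assms] by auto
    obtain B C where "\<forall>\<^sub>F s in at_left t. norm (xdot t0 t1 x s) \<le> B"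
        "\<forall>\<^sub>F s in at_right t. norm (xdot t0 t1 x s) \<le> C"
      using KC1_one_sided_limits[OF assms ti] bd by meson
    then have "\<forall>\<^sub>F s in at_left t. norm (xdot t0 t1 x s) \<le> max B C"
        "\<forall>\<^sub>F s in at_right t. norm (xdot t0 t1 x s) \<le> max B C"
      by (auto elim: eventually_mono)
    then have "\<forall>\<^sub>F s in at t. norm (xdot t0 t1 x s) \<le> max B C"
      by (simp add: eventually_at_split)
    moreover have "at t within {t0..t1} = at t"
      using ti by (intro at_within_interior) auto
    ultimately show ?thesis by metis
  qed
qed auto

lemma continuous_on_xdot_off_finite:
  assumes "angular_points t0 t1 x \<subseteq> N"
  shows "continuous_on ({t0..t1} - N) (xdot t0 t1 x)"
  unfolding continuous_on_eq_continuous_within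
  using assms by (blast intro: continuous_within_subset xdot_continuous_off_angular)

lemma Lagrangian_integrable:
  fixes x :: "real \<Rightarrow> real^'n::finite"
  assumes "x \<in> KC1 t0 t1" "{t0..t1} \<subseteq> S"
    and L: "continuous_on (S \<times> UNIV \<times> UNIV) (\<lambda>(t, x, v). L t x v)"
  shows "(\<lambda>t. L t (x t) (xdot t0 t1 x t) :: real) integrable_on {t0..t1}"
proof (rule integrable_bounded_continuous_off_finite)
  have cx: "continuous_on {t0..t1} x" using assms(1) by (simp add: KC1_def)
  obtain B where B: "\<And>t. t \<in> {t0..t1} \<Longrightarrow> norm (xdot t0 t1 x t) \<le> B"
    using bounded_xdot[OF assms(1)] unfolding bounded_iff by blast
  \<comment> \<open>A compact set containing every triple \<open>(t, x t, xdot t0 t1 x t)\<close>;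
    the bound \<open>B\<close> also covers the arbitrary derivative values at corners.\<close>
  let ?K = "{t0..t1} \<times> x ` {t0..t1} \<times> cball (0 :: real^'n) B"
  have "compact ?K" by (intro compact_Times compact_continuous_image cx) auto
  moreover have "continuous_on ?K (\<lambda>(t, x, v). L t x v)"
    by (rule continuous_on_subset[OF L]) (use assms(2) in auto)
  ultimately have "bounded ((\<lambda>(t, x, v). L t x v) ` ?K)"
    using compact_continuous_image compact_imp_bounded by blast
  then show "bounded ((\<lambda>t. L t (x t) (xdot t0 t1 x t)) ` {t0..t1})"
    by (rule bounded_subset) (use B in \<open>force simp: image_iff\<close>)
  let ?N = "angular_points t0 t1 x"
  show "finite ?N" using KC1_finite_angular[OF assms(1)] .
  have "continuous_on ({t0..t1} - ?N) (\<lambda>t. (\<lambda>(t, x, v). L t x v) (t, x t, xdot t0 t1 x t))"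
    by (rule continuous_on_compose2[OF L])
      (use assms(2) in \<open>auto intro!: continuous_intros continuous_on_xdot_off_finite
         continuous_on_subset[OF cx]\<close>)
  then show "continuous_on ({t0..t1} - ?N) (\<lambda>t. L t (x t) (xdot t0 t1 x t))" by simp
qed

subsection \<open>Tooth functions\<close>

text \<open>A broken line supported on \<open>[c, d]\<close> with break at \<open>m\<close>. The
  second piece is written through its zero at \<open>d\<close>, so continuity is a condition at
  \<open>m\<close> only, namely \<open>p * (m - c) = q * (m - d)\<close>.\<close>

definition tooth :: "real \<Rightarrow> real \<Rightarrow> real \<Rightarrow> real \<Rightarrow> real \<Rightarrow> real \<Rightarrow> real" where
  "tooth c m d p q t =
     (if t \<le> c then 0 else if t \<le> m then p * (t - c) else if t \<le> d then q * (t - d) else 0)"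

definition tooth_slope :: "real \<Rightarrow> real \<Rightarrow> real \<Rightarrow> real \<Rightarrow> real \<Rightarrow> real \<Rightarrow> real" where
  "tooth_slope c m d p q t =
     (if t \<le> c then 0 else if t \<le> m then p else if t \<le> d then q else 0)"

lemma continuous_on_tooth:
  assumes "c < m" "m < d" "p * (m - c) = q * (m - d)"
  shows "continuous_on UNIV (tooth c m d p q)"
proof -
  \<comment> \<open>Clamping \<open>t\<close> to \<open>[c, m]\<close> and to \<open>[m, d]\<close>
    integrates the two slopes; the matching condition makes the total increment zero, as required
    beyond \<open>d\<close>.\<close>
  have "tooth c m d p q = 
    (\<lambda>t. p * (max c (min m t) - c) + q * (max m (min d t) - m))"
    using assms by (auto simp: tooth_def fun_eq_iff min_def max_def algebra_simps)
  then show ?thesis by (auto intro!: continuous_intros)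
qed

lemma tooth_slope_locally_constant:
  assumes "c < m" "m < d" "t \<notin> {c, m, d}"
  shows "\<exists>U. open U \<and> t \<in> U \<and> (\<forall>s\<in>U. tooth_slope c m d p q s = tooth_slope c m d p q t) \<and>
    (\<forall>s\<in>U. tooth c m d p q s = tooth c m d p q t + tooth_slope c m d p q t * (s - t))"
proof -
  consider "t < c" | "c < t" "t < m" | "m < t" "t < d" | "d < t" using assms by force
  then show ?thesis
  proof cases
    case 1
    then show ?thesis using assms
      by (intro exI[of _ "{..<c}"]) (auto simp: tooth_def tooth_slope_def)
  next
    case 2
    then show ?thesis using assms
      by (intro exI[of _ "{c<..<m}"]) (auto simp: tooth_def tooth_slope_def algebra_simps)
  next
    case 3
    then show ?thesis using assms
      by (intro exI[of _ "{m<..<d}"]) (auto simp: tooth_def tooth_slope_def algebra_simps)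
  next
    case 4
    then show ?thesis using assms
      by (intro exI[of _ "{d<..}"]) (auto simp: tooth_def tooth_slope_def)
  qed
qed

lemma tooth_KC1:
  fixes \<eta> :: "real^'n::finite"
  assumes "t0 < c" "c < m" "m < d" "d < t1" "p * (m - c) = q * (m - d)"
  shows "(\<lambda>t. tooth c m d p q t *\<^sub>R \<eta>) \<in> KC1 t0 t1"
    and "angular_points t0 t1 (\<lambda>t. tooth c m d p q t *\<^sub>R \<eta>) \<subseteq> {c, m, d}"
    and "\<And>t. t \<in> {t0..t1} - {c, m, d} \<Longrightarrow>
           xdot t0 t1 (\<lambda>t. tooth c m d p q t *\<^sub>R \<eta>) t = tooth_slope c m d p q t *\<^sub>R \<eta>"
proof -
  let ?x = "\<lambda>t. tooth c m d p q t *\<^sub>R \<eta>" and ?y = "\<lambda>t. tooth_slope c m d p q t *\<^sub>R \<eta>"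
  have "t0 < t1" "finite {c, m, d}" "{c, m, d} \<subseteq> {t0<..<t1}" using assms by auto
  moreover have "continuous_on {t0..t1} ?x"
    using continuous_on_tooth[OF assms(2,3,5)]
    by (intro continuous_intros) (auto intro: continuous_on_subset)
  moreover have "(?x has_vector_derivative ?y t) (at t within {t0..t1})"
      "continuous (at t within {t0..t1}) ?y" if t: "t \<in> {t0..t1} - {c, m, d}" for t
  proof -
    obtain U where U: "open U" "t \<in> U"
      "\<And>s. s \<in> U \<Longrightarrow> tooth_slope c m d p q s = tooth_slope c m d p q t"
      "\<And>s. s \<in> U \<Longrightarrow> tooth c m d p q s = tooth c m d p q t + tooth_slope c m d p q t * (s - t)"
      using tooth_slope_locally_constant[OF assms(2,3), of t p q] t by blast
    have "((\<lambda>s. (tooth c m d p q t + tooth_slope c m d p q t * (s - t)) *\<^sub>R \<eta>)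
            has_vector_derivative ?y t) (at t)"
      by (auto intro!: derivative_eq_intros simp: has_vector_derivative_def)
    then have "(?x has_vector_derivative ?y t) (at t)"
      by (rule has_vector_derivative_transform_within_open[OF _ U(1,2)]) (simp add: U(4))
    then show "(?x has_vector_derivative ?y t) (at t within {t0..t1})"
      by (rule has_vector_derivative_at_within)
    have "\<forall>\<^sub>F s in at t within {t0..t1}. ?y s = ?y t"
      unfolding eventually_at_topological using U(1-3) by metis
    then show "continuous (at t within {t0..t1}) ?y"
      unfolding continuous_within by (rule tendsto_eventually)
  qed
  moreover have "\<exists>l. (?y \<longlongrightarrow> l) (at_left s)" if "s \<in> {c, m, d}" for s
  proof -
    have "\<forall>\<^sub>F u in at_left c. ?y u = 0"
      using assms by (intro eventually_at_leftI[of t0 c]) (auto simp: tooth_slope_def)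
    moreover have "\<forall>\<^sub>F u in at_left m. ?y u = p *\<^sub>R \<eta>"
      using assms by (intro eventually_at_leftI[of c m]) (auto simp: tooth_slope_def)
    moreover have "\<forall>\<^sub>F u in at_left d. ?y u = q *\<^sub>R \<eta>"
      using assms by (intro eventually_at_leftI[of m d]) (auto simp: tooth_slope_def)
    ultimately show ?thesis using that by (metis insertE singletonD tendsto_eventually)
  qed
  moreover have "\<exists>r. (?y \<longlongrightarrow> r) (at_right s)" if "s \<in> {c, m, d}" for s
  proof -
    have "\<forall>\<^sub>F u in at_right c. ?y u = p *\<^sub>R \<eta>"
      using assms by (intro eventually_at_rightI[of c m]) (auto simp: tooth_slope_def)
    moreover have "\<forall>\<^sub>F u in at_right m. ?y u = q *\<^sub>R \<eta>"
      using assms by (intro eventually_at_rightI[of m d]) (auto simp: tooth_slope_def)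
    moreover have "\<forall>\<^sub>F u in at_right d. ?y u = 0"
      using assms by (intro eventually_at_rightI[of d t1]) (auto simp: tooth_slope_def)
    ultimately show ?thesis using that by (metis insertE singletonD tendsto_eventually)
  qed
  ultimately show "?x \<in> KC1 t0 t1" "angular_points t0 t1 ?x \<subseteq> {c, m, d}"
    "\<And>t. t \<in> {t0..t1} - {c, m, d} \<Longrightarrow> xdot t0 t1 ?x t = ?y t"
    using KC1I[of t0 t1 "{c, m, d}" ?x ?y] by blast+
qed

subsection \<open>Third-order asymptotics of the tooth integrals\<close>

text \<open>The first-order expansion of the \<open>s\<close>-derivative \<open>g\<close> at one
  point is integrated in \<open>s\<close>. Since \<open>\<Phi> t 0 = 0\<close> for all
  \<open>t\<close> near \<open>c\<close>, no pure \<open>\<tau>\<close> terms occur and the error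
  gains a factor \<open>|s|\<close>.\<close>

lemma second_order_expansion:
  fixes \<Phi> g :: "real \<Rightarrow> real \<Rightarrow> real"
  assumes g: "((\<lambda>(t, s). g t s) has_derivative (\<lambda>(\<tau>, s). \<tau> * A + s * Q)) (at (c, 0))"
    and U: "open U" "c \<in> U"
    and \<Phi>: "\<And>t s. t \<in> U \<Longrightarrow> (\<Phi> t has_real_derivative g t s) (at s)" "\<And>t. t \<in> U \<Longrightarrow> \<Phi> t 0 = 0"
    and "e > 0"
  shows "\<exists>\<rho>>0. \<forall>\<tau> s. \<bar>\<tau>\<bar> < \<rho> \<longrightarrow> \<bar>s\<bar> < \<rho> \<longrightarrow>
    \<bar>\<Phi> (c + \<tau>) s - (s * g c 0 + \<tau> * s * A + s\<^sup>2 / 2 * Q)\<bar> \<le> e * (\<bar>\<tau>\<bar> + \<bar>s\<bar>) * \<bar>s\<bar>"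
proof -
  obtain d where d: "d > 0" and gd: "\<And>y :: real \<times> real. norm (y - (c, 0)) < d \<Longrightarrow>
      norm ((\<lambda>(t, s). g t s) y - (\<lambda>(t, s). g t s) (c, 0) - (\<lambda>(\<tau>, s). \<tau> * A + s * Q) (y - (c, 0)))
       \<le> e * norm (y - (c, 0))"
    using g \<open>e > 0\<close> unfolding has_derivative_at_alt by meson
  obtain r where r: "r > 0" "\<And>t. \<bar>t - c\<bar> < r \<Longrightarrow> t \<in> U"
    using U unfolding open_dist dist_real_def by meson
  \<comment> \<open>Half the radius suffices for each coordinate, because the norm of a pair is at
    most the sum of the absolute values.\<close>
  have gb: "\<bar>g (c + \<tau>) u - g c 0 - (\<tau> * A + u * Q)\<bar> \<le> e * (\<bar>\<tau>\<bar> + \<bar>u\<bar>)"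
    if "\<bar>\<tau>\<bar> < d / 2" "\<bar>u\<bar> < d / 2" for \<tau> u :: real
  proof -
    have le: "norm (\<tau>, u) \<le> \<bar>\<tau>\<bar> + \<bar>u\<bar>"
      using norm_Pair_le[of \<tau> u] by simp
    then have "norm ((c + \<tau>, u) - (c, 0)) < d" using that by simp
    from gd[OF this] have "\<bar>g (c + \<tau>) u - g c 0 - (\<tau> * A + u * Q)\<bar> \<le> e * norm (\<tau>, u)" by simp
    also have "\<dots> \<le> e * (\<bar>\<tau>\<bar> + \<bar>u\<bar>)" using le \<open>e > 0\<close> by simp
    finally show ?thesis .
  qed
  have "\<bar>\<Phi> (c + \<tau>) s - (s * g c 0 + \<tau> * s * A + s\<^sup>2 / 2 * Q)\<bar> \<le> e * (\<bar>\<tau>\<bar> + \<bar>s\<bar>) * \<bar>s\<bar>"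
    if b: "\<bar>\<tau>\<bar> < min r (d / 2)" "\<bar>s\<bar> < min r (d / 2)" for \<tau> s
  proof -
    \<comment> \<open>The derivative of the remainder \<open>\<psi>\<close> is the first-order error
      of \<open>g\<close>, so the mean value inequality between \<open>0\<close> and
      \<open>s\<close> bounds the remainder.\<close>
    define \<psi> where "\<psi> u = \<Phi> (c + \<tau>) u - (u * g c 0 + \<tau> * u * A + u\<^sup>2 / 2 * Q)" for u
    have U\<tau>: "c + \<tau> \<in> U" using r b by auto
    have "norm (\<psi> s - \<psi> 0) \<le> e * (\<bar>\<tau>\<bar> + \<bar>s\<bar>) * norm (s - 0)"
    proof (rule field_differentiable_bound[of "cball 0 \<bar>s\<bar>"])
      fix u :: real assume "u \<in> cball 0 \<bar>s\<bar>"
      then have u: "\<bar>u\<bar> \<le> \<bar>s\<bar>" by simp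
      show "(\<psi> has_field_derivative g (c + \<tau>) u - g c 0 - (\<tau> * A + u * Q)) (at u within cball 0 \<bar>s\<bar>)"
        unfolding \<psi>_def
        by (rule has_field_derivative_at_within)
          (auto intro!: derivative_eq_intros \<Phi>(1)[OF U\<tau>])
      have "e * (\<bar>\<tau>\<bar> + \<bar>u\<bar>) \<le> e * (\<bar>\<tau>\<bar> + \<bar>s\<bar>)" using u \<open>e > 0\<close> by simp
      then show "norm (g (c + \<tau>) u - g c 0 - (\<tau> * A + u * Q)) \<le> e * (\<bar>\<tau>\<bar> + \<bar>s\<bar>)"
        using gb[of \<tau> u] b u by simp
    qed auto
    then show ?thesis using \<Phi>(2)[OF U\<tau>] by (simp add: \<psi>_def)
  qed
  then show ?thesis using r(1) d by (intro exI[of _ "min r (d / 2)"]) auto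
qed

text \<open>\<open>P\<close> is the antiderivative, in \<open>w = t - d\<close>, of the quadratic
  model evaluated at \<open>s = k * (t - d)\<close>. Its term with \<open>d - c\<close> comes from
  \<open>t - c = w + (d - c)\<close>.\<close>

lemma affine_piece_integral_bound:
  fixes F :: "real \<Rightarrow> real"
  defines "P \<equiv> \<lambda>k d c G A Q w. k * G * w\<^sup>2 / 2 + k * A * (w ^ 3 / 3 + (d - c) * w\<^sup>2 / 2) + k\<^sup>2 * Q * w ^ 3 / 6"
  assumes "(F has_integral I) {u..v}" "u \<le> v" "0 \<le> B"
    and "\<And>t. t \<in> {u..v} \<Longrightarrow> \<bar>F t - (k * (t - d) * G + (t - c) * (k * (t - d)) * A + (k * (t - d))\<^sup>2 / 2 * Q)\<bar> \<le> B"
  shows "\<bar>I - (P k d c G A Q (v - d) - P k d c G A Q (u - d))\<bar> \<le> B * (v - u)"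
proof -
  let ?p = "\<lambda>t. k * (t - d) * G + (t - c) * (k * (t - d)) * A + (k * (t - d))\<^sup>2 / 2 * Q"
  have "((\<lambda>t. P k d c G A Q (t - d)) has_vector_derivative ?p t) (at t within {u..v})" for t
    unfolding P_def has_real_derivative_iff_has_vector_derivative[symmetric]
    by (auto intro!: derivative_eq_intros) (simp add: field_simps power2_eq_square power3_eq_cube)
  then have "(?p has_integral P k d c G A Q (v - d) - P k d c G A Q (u - d)) {u..v}"
    using fundamental_theorem_of_calculus[OF assms(3), of "\<lambda>t. P k d c G A Q (t - d)" ?p] by blast
  then have "((\<lambda>t. F t - ?p t) has_integral I - (P k d c G A Q (v - d) - P k d c G A Q (u - d))) {u..v}"
    by (rule has_integral_diff[OF assms(2)])
  from has_integral_bound_real[OF assms(4) finite.emptyI this] show ?thesis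
    using assms(3,5) by simp
qed

text \<open>Dividing by \<open>h\<^sup>2\<close> and letting \<open>h\<close> tend to zero isolates
  \<open>p\<close>. If \<open>p\<close> vanishes, a further division by \<open>h\<close> leaves
  \<open>q + e\<close> with \<open>e\<close> arbitrary.\<close>

lemma eventually_cubic_nonneg:
  fixes p q :: real
  assumes "\<And>e. e > 0 \<Longrightarrow> \<exists>\<rho>>0. \<forall>h. 0 < h \<and> h < \<rho> \<longrightarrow> 0 \<le> p * h\<^sup>2 + q * h ^ 3 + e * h ^ 3"
  shows "0 \<le> p" and "p = 0 \<Longrightarrow> 0 \<le> q"
proof -
  have *: "\<exists>\<rho>>0. \<forall>h. 0 < h \<and> h < \<rho> \<longrightarrow> 0 \<le> p + (q + e) * h" if "e > 0" for e
  proof -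
    obtain \<rho> where \<rho>: "\<rho> > 0" "\<And>h. 0 < h \<Longrightarrow> h < \<rho> \<Longrightarrow> 0 \<le> p * h\<^sup>2 + q * h ^ 3 + e * h ^ 3"
      using assms[OF \<open>e > 0\<close>] by metis
    have "0 \<le> p + (q + e) * h" if "0 < h" "h < \<rho>" for h
    proof -
      have "0 \<le> h\<^sup>2 * (p + (q + e) * h)"
        using \<rho>(2)[OF that] by (simp add: algebra_simps power2_eq_square power3_eq_cube)
      then show ?thesis using that by (simp add: zero_le_mult_iff)
    qed
    then show ?thesis using \<rho>(1) by blast
  qed
  show "0 \<le> p"
  proof -
    obtain \<rho> where \<rho>: "\<rho> > 0" "\<And>h. 0 < h \<Longrightarrow> h < \<rho> \<Longrightarrow> 0 \<le> p + (q + 1) * h"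
      using *[of 1] by auto
    have "((\<lambda>h. p + (q + 1) * h) \<longlongrightarrow> p + (q + 1) * 0) (at_right 0)"
      by (intro tendsto_intros)
    moreover have "\<forall>\<^sub>F h in at_right 0. 0 \<le> p + (q + 1) * h"
      using \<rho> by (intro eventually_at_rightI[of 0 \<rho>]) auto
    ultimately show ?thesis
      using tendsto_lowerbound[of "\<lambda>h. p + (q + 1) * h" _ "at_right 0" 0] by simp
  qed
  show "0 \<le> q" if "p = 0"
  proof (rule field_le_epsilon)
    fix e :: real assume "e > 0"
    then obtain \<rho> where \<rho>: "\<rho> > 0" "\<And>h. 0 < h \<Longrightarrow> h < \<rho> \<Longrightarrow> 0 \<le> p + (q + e) * h"
      using *[OF \<open>e > 0\<close>] by metis
    from \<rho>(2)[of "\<rho> / 2"] show "0 \<le> q + e" using \<rho>(1) that by (simp add: zero_le_mult_iff)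
  qed
qed

text \<open>The expansions are integrated along \<open>s = t - c\<close> and
  \<open>s = k l * (t - (c + h))\<close>, the two sides of the tooth, which agree at the break. The
  coefficients of \<open>h\<^sup>2\<close> and \<open>h ^ 3\<close> in the sum are \<open>p\<close>
  and \<open>q\<close> below, and \<open>eventually_cubic_nonneg\<close> yields their signs.\<close>

lemma tooth_integrals_nonneg:
  fixes \<Phi>1 \<Phi>2 :: "real \<Rightarrow> real \<Rightarrow> real"
  defines "k \<equiv> \<lambda>l::real. inverse (l - 1) * l"
  assumes l: "0 < l" "l < 1"
    and e1: "\<And>e. e > 0 \<Longrightarrow> \<exists>\<rho>>0. \<forall>\<tau> s. \<bar>\<tau>\<bar> < \<rho> \<longrightarrow> \<bar>s\<bar> < \<rho> \<longrightarrow>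
      \<bar>\<Phi>1 (c + \<tau>) s - (s * G1 + \<tau> * s * A1 + s\<^sup>2 / 2 * Q1)\<bar> \<le> e * (\<bar>\<tau>\<bar> + \<bar>s\<bar>) * \<bar>s\<bar>"
    and e2: "\<And>e. e > 0 \<Longrightarrow> \<exists>\<rho>>0. \<forall>\<tau> s. \<bar>\<tau>\<bar> < \<rho> \<longrightarrow> \<bar>s\<bar> < \<rho> \<longrightarrow>
      \<bar>\<Phi>2 (c + \<tau>) s - (s * G2 + \<tau> * s * A2 + s\<^sup>2 / 2 * Q2)\<bar> \<le> e * (\<bar>\<tau>\<bar> + \<bar>s\<bar>) * \<bar>s\<bar>"
    and nonneg: "\<exists>\<rho>>0. \<forall>h. 0 < h \<and> h < \<rho> \<longrightarrow>
      (\<exists>I1 I2. ((\<lambda>t. \<Phi>1 t (t - c)) has_integral I1) {c..c + l * h} \<and>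
         ((\<lambda>t. \<Phi>2 t (k l * (t - (c + h)))) has_integral I2) {c + l * h..c + h} \<and> 0 \<le> I1 + I2)"
  shows "0 \<le> l * G1 + (1 - l) * G2"
    and "l * G1 + (1 - l) * G2 = 0 \<Longrightarrow> l * A1 + (1 - l) * A2 = 0 \<Longrightarrow> 0 \<le> l * Q1 + (1 - l) * Q2 - A1"
proof -
  define p where "p = l / 2 * (l * G1 + (1 - l) * G2)"
  define q where "q = A1 * l ^ 3 / 3 + Q1 * l ^ 3 / 6 + A2 * (l\<^sup>2 * (1 - l) / 2 + l * (1 - l)\<^sup>2 / 6)
    + Q2 * l\<^sup>2 * (1 - l) / 6"
  have kl: "k l * (l - 1) = l" using l by (simp add: k_def)
  have main: "\<exists>\<rho>>0. \<forall>h. 0 < h \<and> h < \<rho> \<longrightarrow> 0 \<le> p * h\<^sup>2 + q * h ^ 3 + e * h ^ 3" if "e > 0" for e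
  proof -
    \<comment> \<open>With both arguments at most \<open>h\<close> in absolute value,
      \<open>(|\<tau>| + |s|) * |s|\<close> is at most \<open>2 * h\<^sup>2\<close>. Hence the
      factor \<open>e / 2\<close>: the pointwise error is at most \<open>e * h\<^sup>2\<close>, and
      over total length \<open>h\<close> it integrates to at most \<open>e * h ^ 3\<close>.\<close>
    have "e / 2 > 0" using that by simp
    obtain \<rho>1 where \<rho>1: "\<rho>1 > 0" and b1: "\<forall>\<tau> s. \<bar>\<tau>\<bar> < \<rho>1 \<longrightarrow> \<bar>s\<bar> < \<rho>1 \<longrightarrow>
        \<bar>\<Phi>1 (c + \<tau>) s - (s * G1 + \<tau> * s * A1 + s\<^sup>2 / 2 * Q1)\<bar> \<le> e / 2 * (\<bar>\<tau>\<bar> + \<bar>s\<bar>) * \<bar>s\<bar>"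
      using e1[OF \<open>e / 2 > 0\<close>] by (elim exE conjE)
    obtain \<rho>2 where \<rho>2: "\<rho>2 > 0" and b2: "\<forall>\<tau> s. \<bar>\<tau>\<bar> < \<rho>2 \<longrightarrow> \<bar>s\<bar> < \<rho>2 \<longrightarrow>
        \<bar>\<Phi>2 (c + \<tau>) s - (s * G2 + \<tau> * s * A2 + s\<^sup>2 / 2 * Q2)\<bar> \<le> e / 2 * (\<bar>\<tau>\<bar> + \<bar>s\<bar>) * \<bar>s\<bar>"
      using e2[OF \<open>e / 2 > 0\<close>] by (elim exE conjE)
    obtain \<rho>3 where \<rho>3: "\<rho>3 > 0" and nn: "\<forall>h. 0 < h \<and> h < \<rho>3 \<longrightarrow>
         (\<exists>I1 I2. ((\<lambda>t. \<Phi>1 t (t - c)) has_integral I1) {c..c + l * h} \<and>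
         ((\<lambda>t. \<Phi>2 t (k l * (t - (c + h)))) has_integral I2) {c + l * h..c + h} \<and> 0 \<le> I1 + I2)"
      using nonneg by (elim exE conjE)
    have "0 \<le> p * h\<^sup>2 + q * h ^ 3 + e * h ^ 3" if h: "0 < h" "h < min \<rho>1 (min \<rho>2 \<rho>3)" for h
    proof -
      obtain I1 I2 where I1: "((\<lambda>t. \<Phi>1 t (t - c)) has_integral I1) {c..c + l * h}"
        and I2: "((\<lambda>t. \<Phi>2 t (k l * (t - (c + h)))) has_integral I2) {c + l * h..c + h}"
        and I: "0 \<le> I1 + I2"
        using nn[rule_format, of h] h by auto
      have lh: "0 < l * h" "l * h < h" using l h by auto
      have err: "e / 2 * (\<bar>\<tau>\<bar> + \<bar>s\<bar>) * \<bar>s\<bar> \<le> e * h\<^sup>2" if "\<bar>\<tau>\<bar> \<le> h" "\<bar>s\<bar> \<le> h" for \<tau> s :: real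
      proof -
        have "(\<bar>\<tau>\<bar> + \<bar>s\<bar>) * \<bar>s\<bar> \<le> (h + h) * h"
          using that h by (intro mult_mono) auto
        from mult_left_mono[OF this, of "e / 2"] show ?thesis
          using \<open>e > 0\<close> by (simp add: power2_eq_square algebra_simps)
      qed
      have "\<bar>I1 - ((1 * G1 * (c + l * h - c)\<^sup>2 / 2 + 1 * A1 * ((c + l * h - c) ^ 3 / 3 + (c - c) * (c + l * h - c)\<^sup>2 / 2)
            + 1\<^sup>2 * Q1 * (c + l * h - c) ^ 3 / 6)
          - (1 * G1 * (c - c)\<^sup>2 / 2 + 1 * A1 * ((c - c) ^ 3 / 3 + (c - c) * (c - c)\<^sup>2 / 2)
            + 1\<^sup>2 * Q1 * (c - c) ^ 3 / 6))\<bar> \<le> e * h\<^sup>2 * (c + l * h - c)"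
      proof (rule affine_piece_integral_bound[OF I1])
        fix t assume t: "t \<in> {c..c + l * h}"
        then have tc: "\<bar>t - c\<bar> < h" using lh unfolding atLeastAtMost_iff by linarith
        have "\<bar>\<Phi>1 (c + (t - c)) (t - c) - ((t - c) * G1 + (t - c) * (t - c) * A1 + (t - c)\<^sup>2 / 2 * Q1)\<bar>
          \<le> e / 2 * (\<bar>t - c\<bar> + \<bar>t - c\<bar>) * \<bar>t - c\<bar>"
          by (rule b1[rule_format]) (use tc h in auto)
        also have "\<dots> \<le> e * h\<^sup>2" by (rule err) (use tc in auto)
        finally show "\<bar>\<Phi>1 t (t - c) - (1 * (t - c) * G1 + (t - c) * (1 * (t - c)) * A1 + (1 * (t - c))\<^sup>2 / 2 * Q1)\<bar>
          \<le> e * h\<^sup>2" by simp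
      qed (use lh(2) \<open>e > 0\<close> l h in auto)
      then have 1: "\<bar>I1 - (G1 * (l * h)\<^sup>2 / 2 + A1 * (l * h) ^ 3 / 3 + Q1 * (l * h) ^ 3 / 6)\<bar> \<le> e * h\<^sup>2 * (l * h)"
        by simp
      \<comment> \<open>On the second piece \<open>d = c + h\<close>, so the antiderivative vanishes
        at the right end and only its value at the left end, where \<open>t - d\<close> equals
        \<open>?w\<close>, remains.\<close>
      let ?w = "(l - 1) * h" and ?P = "\<lambda>w. k l * G2 * w\<^sup>2 / 2 + k l * A2 * (w ^ 3 / 3 + (c + h - c) * w\<^sup>2 / 2)
            + (k l)\<^sup>2 * Q2 * w ^ 3 / 6"
      have "\<bar>I2 - (?P (c + h - (c + h)) - ?P (c + l * h - (c + h)))\<bar> \<le> e * h\<^sup>2 * (c + h - (c + l * h))"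
      proof (rule affine_piece_integral_bound[OF I2])
        fix t assume t: "t \<in> {c + l * h..c + h}"
        then have tc: "\<bar>t - c\<bar> \<le> h" using lh unfolding atLeastAtMost_iff by linarith
        let ?s = "k l * (t - (c + h))"
        \<comment> \<open>Since \<open>k l\<close> is negative, \<open>?s\<close> decreases in
          \<open>t\<close> and is largest at the break, where it equals
          \<open>l * h\<close>.\<close>
        have kneg: "k l \<le> 0" using l by (simp add: k_def mult_nonpos_nonneg)
        have "?s \<le> k l * ((l - 1) * h)"
          using t kneg by (intro mult_left_mono_neg) (auto simp: algebra_simps)
        also have "\<dots> = l * h" using kl by (simp flip: mult.assoc)
        finally have s: "\<bar>?s\<bar> \<le> l * h"
          using t kneg by (simp add: mult_nonpos_nonpos)
        then have sh: "\<bar>?s\<bar> < h" using lh by linarith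
        have "\<bar>\<Phi>2 (c + (t - c)) ?s - (?s * G2 + (t - c) * ?s * A2 + ?s\<^sup>2 / 2 * Q2)\<bar>
          \<le> e / 2 * (\<bar>t - c\<bar> + \<bar>?s\<bar>) * \<bar>?s\<bar>"
          by (rule b2[rule_format]) (use tc sh h in auto)
        also have "\<dots> \<le> e * h\<^sup>2" by (rule err) (use tc sh in auto)
        finally show "\<bar>\<Phi>2 t ?s - (?s * G2 + (t - c) * ?s * A2 + ?s\<^sup>2 / 2 * Q2)\<bar> \<le> e * h\<^sup>2" by simp
      qed (use lh(2) \<open>e > 0\<close> l h in auto)
      moreover have "c + l * h - (c + h) = ?w" by (simp add: algebra_simps)
      ultimately have "\<bar>I2 - (- ?P ?w)\<bar> \<le> e * h\<^sup>2 * (c + h - (c + l * h))" by simp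
      moreover have "- ?P ?w = G2 * (l * (1 - l) * h\<^sup>2 / 2) + A2 * (l\<^sup>2 * (1 - l) / 2 + l * (1 - l)\<^sup>2 / 6) * h ^ 3
          + Q2 * l\<^sup>2 * (1 - l) / 6 * h ^ 3"
      proof -
        \<comment> \<open>Every term of \<open>?P w\<close> carries a factor \<open>k l * w\<close>,
          so this relation removes the fraction \<open>k l\<close> and leaves a polynomial in
          \<open>l\<close> and \<open>h\<close>.\<close>
        have "k l * ?w = l * h" using kl by (simp flip: mult.assoc)
        moreover have "?P w = (k l * w) * G2 * w / 2 + (k l * w) * A2 * (w\<^sup>2 / 3 + h * w / 2)
            + (k l * w)\<^sup>2 * Q2 * w / 6" for w
          by (simp add: field_simps power2_eq_square power3_eq_cube)
        ultimately have "?P ?w = (l * h) * G2 * ?w / 2 + (l * h) * A2 * (?w\<^sup>2 / 3 + h * ?w / 2)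
            + (l * h)\<^sup>2 * Q2 * ?w / 6"
          by presburger
        then show ?thesis by (simp add: field_simps power2_eq_square power3_eq_cube)
      qed
      ultimately have 2: "\<bar>I2 - (G2 * (l * (1 - l) * h\<^sup>2 / 2) + A2 * (l\<^sup>2 * (1 - l) / 2 + l * (1 - l)\<^sup>2 / 6) * h ^ 3
          + Q2 * l\<^sup>2 * (1 - l) / 6 * h ^ 3)\<bar> \<le> e * h\<^sup>2 * (c + h - (c + l * h))" by simp
      have 3: "p * h\<^sup>2 + q * h ^ 3 = (G1 * (l * h)\<^sup>2 / 2 + A1 * (l * h) ^ 3 / 3 + Q1 * (l * h) ^ 3 / 6) +
          (G2 * (l * (1 - l) * h\<^sup>2 / 2) + A2 * (l\<^sup>2 * (1 - l) / 2 + l * (1 - l)\<^sup>2 / 6) * h ^ 3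
          + Q2 * l\<^sup>2 * (1 - l) / 6 * h ^ 3)"
        by (simp add: p_def q_def field_simps power2_eq_square power3_eq_cube)
      have 4: "e * h\<^sup>2 * (l * h) + e * h\<^sup>2 * (c + h - (c + l * h)) = e * h ^ 3"
        by (simp add: algebra_simps power2_eq_square power3_eq_cube)
      show ?thesis using 1 2 3 4 I by linarith
    qed
    then show ?thesis using \<rho>1 \<rho>2 \<rho>3 by (intro exI[of _ "min \<rho>1 (min \<rho>2 \<rho>3)"]) auto
  qed
  show "0 \<le> l * G1 + (1 - l) * G2"
    using eventually_cubic_nonneg(1)[OF main] l by (simp add: p_def zero_le_mult_iff)
  assume z: "l * G1 + (1 - l) * G2 = 0" "l * A1 + (1 - l) * A2 = 0"
  have "0 \<le> q" using eventually_cubic_nonneg(2)[OF main] z by (simp add: p_def)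
  also have "q = l\<^sup>2 / 6 * (l * Q1 + (1 - l) * Q2 - A1)"
  proof -
    \<comment> \<open>Isolating \<open>(1 - l) * A2\<close> prepares its replacement by
      \<open>- (l * A1)\<close>; the coefficient of \<open>A1\<close> then becomes \<open>l ^ 3 / 3
      - l ^ 3 / 2 - l\<^sup>2 * (1 - l) / 6 = - l\<^sup>2 / 6\<close>.\<close>
    have "q = A1 * l ^ 3 / 3 + Q1 * l ^ 3 / 6 + ((1 - l) * A2) * (l\<^sup>2 / 2 + l * (1 - l) / 6)
        + Q2 * l\<^sup>2 * (1 - l) / 6"
      by (simp add: q_def field_simps power2_eq_square)
    also have "(1 - l) * A2 = - (l * A1)" using z by simp
    finally show ?thesis by (simp add: field_simps power2_eq_square power3_eq_cube)
  qed
  finally show "0 \<le> l * Q1 + (1 - l) * Q2 - A1" using l by (simp add: zero_le_mult_iff)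
qed

subsection \<open>Partial gradients of the Lagrangian\<close>

text \<open>Makes the definite description meaningful: a representing vector is assembled from the
  values of the derivative on the basis, and two representing vectors agree on testing with their
  difference.\<close>

lemma GDERIV_gradient:
  fixes f :: "'a::euclidean_space \<Rightarrow> real"
  assumes "f differentiable (at x)"
  shows "GDERIV f x :> gradient f x"
proof -
  obtain f' where f': "(f has_derivative f') (at x)" using assms unfolding differentiable_def by auto
  let ?D = "\<Sum>b\<in>Basis. f' b *\<^sub>R b"
  have "f' h = inner h ?D" for h
  proof -
    have "f' h = f' (\<Sum>b\<in>Basis. inner h b *\<^sub>R b)" by (simp add: euclidean_representation)
    also have "\<dots> = (\<Sum>b\<in>Basis. inner h b * f' b)"
      using has_derivative_linear[OF f'] by (simp add: linear_sum linear_cmul)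
    also have "\<dots> = inner h ?D" by (simp add: inner_sum_right mult.commute)
    finally show ?thesis .
  qed
  then have "f' = (\<lambda>h. inner h ?D)" by blast
  then have "GDERIV f x :> ?D" using f' unfolding gderiv_def by simp
  moreover have "E = D" if "GDERIV f x :> D" "GDERIV f x :> E" for D E
  proof -
    have "(\<lambda>h. inner h E) = (\<lambda>h. inner h D)"
      using that unfolding gderiv_def by (metis has_derivative_unique)
    then have "inner (E - D) E = inner (E - D) D" by meson
    then have "inner (E - D) (E - D) = 0" by (simp only: inner_diff_right[of _ E D])
    then show ?thesis by simp
  qed
  ultimately show ?thesis unfolding gradient_def by (metis theI)
qed

lemma C1_on_differentiable: "C1_on f S \<Longrightarrow> p \<in> S \<Longrightarrow> f differentiable (at p)"
  unfolding C1_on_def differentiable_def by blast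

lemma C1_on_continuous_on: "C1_on f S \<Longrightarrow> continuous_on S f"
  by (intro continuous_at_imp_continuous_on ballI differentiable_imp_continuous_within C1_on_differentiable)

lemma grad_x_DERIV:
  fixes L :: "('n::finite) lagrangian"
  assumes "(\<lambda>(t, x, v). L t x v) differentiable (at (t, y + s *\<^sub>R \<eta>, v))"
  shows "((\<lambda>s. L t (y + s *\<^sub>R \<eta>) v) has_real_derivative grad_x L t (y + s *\<^sub>R \<eta>) v \<bullet> \<eta>) (at s)"
proof -
  have "(\<lambda>x. (t, x, v)) differentiable (at (y + s *\<^sub>R \<eta>))"
    unfolding differentiable_def by (rule exI[of _ "\<lambda>h. (0, h, 0)"]) (auto intro!: derivative_eq_intros)
  from differentiable_chain_at[OF this assms]
  have "(\<lambda>x. L t x v) differentiable (at (y + s *\<^sub>R \<eta>))" by (simp add: o_def)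
  from GDERIV_gradient[OF this]
  have "((\<lambda>x. L t x v) has_derivative (\<lambda>h. h \<bullet> grad_x L t (y + s *\<^sub>R \<eta>) v)) (at (y + s *\<^sub>R \<eta>))"
    by (simp add: gderiv_def grad_x_def)
  moreover have "((\<lambda>s. y + s *\<^sub>R \<eta>) has_derivative (\<lambda>r. r *\<^sub>R \<eta>)) (at s)"
    by (auto intro!: derivative_eq_intros)
  ultimately have "((\<lambda>s. L t (y + s *\<^sub>R \<eta>) v) has_derivative
      (\<lambda>r. (r *\<^sub>R \<eta>) \<bullet> grad_x L t (y + s *\<^sub>R \<eta>) v)) (at s)"
    by (rule has_derivative_compose[rotated])
  moreover have "(\<lambda>r. (r *\<^sub>R \<eta>) \<bullet> grad_x L t (y + s *\<^sub>R \<eta>) v) = (*) (grad_x L t (y + s *\<^sub>R \<eta>) v \<bullet> \<eta>)"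
    by (simp add: fun_eq_iff inner_commute)
  ultimately show ?thesis
    unfolding has_field_derivative_def by simp
qed

text \<open>Restricting the total derivative of \<open>grad_x L\<close> to the second slot gives a
  derivative of the partial map, which uniqueness identifies with the Jacobian.\<close>

lemma hess_xx_apply:
  fixes L :: "('n::finite) lagrangian"
  assumes D: "((\<lambda>(t, x, v). grad_x L t x v) has_derivative D) (at (t, x, v))"
  shows "hess_xx L t x v *v h = D (0, h, 0)"
proof -
  have "((\<lambda>x. (t, x, v)) has_derivative (\<lambda>h. (0, h, 0))) (at x)"
    by (auto intro!: derivative_eq_intros)
  from has_derivative_compose[OF this D]
  have "((\<lambda>y. grad_x L t y v) has_derivative (\<lambda>h. D (0, h, 0))) (at x)" by simp
  moreover from this have "((\<lambda>y. grad_x L t y v) has_derivative (\<lambda>h. hess_xx L t x v *v h)) (at x)"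
    unfolding hess_xx_def using jacobian_works differentiableI by blast
  ultimately show ?thesis using has_derivative_unique by metis
qed

subsection \<open>Tooth variations of an extremal\<close>

text \<open>Twice continuous differentiability on the arc is expressed by \<open>xb\<close> and
  \<open>xdot t0 t1 xb\<close> both being C1 there. The ends \<open>a\<close>, \<open>b\<close> are
  extended reals, so the time interval may be unbounded.\<close>

locale extremal_arc =
  fixes L :: "('n::finite) lagrangian"
    and a b :: ereal
    and t0 t1 s0 s1 :: real
    and x0 x1 :: "real^'n"
    and xb :: "real \<Rightarrow> real^'n"
  assumes t0_less_t1: "t0 < t1"
    and interval_subset: "{t0..t1} \<subseteq> einterval a b"
    and L_C1: "C1_on (\<lambda>(t, x, v). L t x v) (einterval a b \<times> UNIV \<times> UNIV)"
    and Lx_C1: "C1_on (\<lambda>(t, x, v). grad_x L t x v) (einterval a b \<times> UNIV \<times> UNIV)"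
    and extremal: "extremal L t0 t1 x0 x1 xb"
    and arc_subset: "{s0<..<s1} \<subseteq> {t0..t1}"
    and xb_C1: "xb C1_differentiable_on {s0<..<s1}"
    and xdot_C1: "xdot t0 t1 xb C1_differentiable_on {s0<..<s1}"
begin

section \<open>Regularity of the extremal on the smooth arc\<close>

abbreviation "vb \<equiv> xdot t0 t1 xb"

text \<open>An open set contained in \<open>{t0..t1}\<close> lies in its interior, so derivatives
  within \<open>{t0..t1}\<close> are two-sided on the arc.\<close>

lemma arc_interior: "t \<in> {s0<..<s1} \<Longrightarrow> t \<in> {t0<..<t1}"
proof -
  assume t: "t \<in> {s0<..<s1}"
  have "{s0<..<s1} \<subseteq> interior {t0..t1}" by (rule interior_maximal[OF arc_subset]) simp
  then show ?thesis using t by auto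
qed

lemma arc_at_within: "t \<in> {s0<..<s1} \<Longrightarrow> at t within {t0..t1} = at t"
  using arc_interior by (intro at_within_interior) auto

lemma arc_einterval: "t \<in> {s0<..<s1} \<Longrightarrow> t \<in> einterval a b"
  using arc_subset interval_subset by blast

lemma vb_derivative: "t \<in> {s0<..<s1} \<Longrightarrow> \<exists>w. (vb has_vector_derivative w) (at t)"
  using xdot_C1 unfolding C1_differentiable_on_def by blast

lemma vb_isCont: "t \<in> {s0<..<s1} \<Longrightarrow> isCont vb t"
  using vb_derivative has_vector_derivative_continuous by blast

text \<open>Makes the Euler equation available at every point of the arc. Continuity of the
  derivative comes from the differentiability of \<open>vb\<close>.\<close>

lemma arc_not_angular: "t \<in> {s0<..<s1} \<Longrightarrow> t \<notin> angular_points t0 t1 xb"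
proof -
  assume t: "t \<in> {s0<..<s1}"
  have "xb differentiable (at t)"
    using xb_C1 t unfolding C1_differentiable_on_def by (blast intro: differentiableI_vector)
  then show ?thesis using vb_isCont[OF t] arc_at_within[OF t] by (simp add: angular_points_def)
qed

lemma xb_derivative: "t \<in> {s0<..<s1} \<Longrightarrow> (xb has_vector_derivative vb t) (at t)"
  using has_vector_derivative_xdot[of t t0 t1 xb] arc_not_angular arc_at_within arc_subset by auto

lemma xb_isCont: "t \<in> {s0<..<s1} \<Longrightarrow> isCont xb t"
  using xb_derivative has_vector_derivative_continuous by blast

lemma Euler: "t \<in> {s0<..<s1} \<Longrightarrow>
    ((\<lambda>s. grad_v L s (xb s) (vb s)) has_vector_derivative grad_x L t (xb t) (vb t)) (at t)"
  using extremal arc_not_angular arc_at_within arc_subset unfolding extremal_def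
  by (metis DiffI subsetD)

lemma xb_admissible: "xb \<in> KC1 t0 t1" "xb t0 = x0" "xb t1 = x1"
  using extremal by (auto simp: extremal_def admissible_def)

section \<open>Expansion of the reduced integrand\<close>

text \<open>The increment of the integrand minus the derivative of \<open>s * (L\<^sub>v \<bullet> \<eta>)\<close> along the extremal,
  where the perturbation is \<open>s *\<^sub>R \<eta>\<close> with velocity \<open>\<xi>\<close>; \<open>\<Phi>'\<close> is its derivative in \<open>s\<close>.\<close>

definition \<Phi> :: "real^'n \<Rightarrow> real^'n \<Rightarrow> real \<Rightarrow> real \<Rightarrow> real" where
  "\<Phi> \<xi> \<eta> t s = L t (xb t + s *\<^sub>R \<eta>) (vb t + \<xi>) - L t (xb t) (vb t)
     - grad_v L t (xb t) (vb t) \<bullet> \<xi> - s * (grad_x L t (xb t) (vb t) \<bullet> \<eta>)"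

definition \<Phi>' :: "real^'n \<Rightarrow> real^'n \<Rightarrow> real \<Rightarrow> real \<Rightarrow> real" where
  "\<Phi>' \<xi> \<eta> t s = (grad_x L t (xb t + s *\<^sub>R \<eta>) (vb t + \<xi>) - grad_x L t (xb t) (vb t)) \<bullet> \<eta>"

text \<open>Degeneration thus says that \<open>\<Phi>\<close> vanishes on the axis
  \<open>s = 0\<close> over the arc, for both slopes.\<close>

lemma \<Phi>_0: "\<Phi> \<xi> \<eta> t 0 = excess L t0 t1 xb t \<xi>"
  by (simp add: \<Phi>_def excess_def)

lemma \<Phi>'_0: "\<Phi>' \<xi> \<eta> t 0 = Delta_Lx L t0 t1 xb t \<xi> \<bullet> \<eta>"
  by (simp add: \<Phi>'_def Delta_Lx_def)

lemma \<Phi>_DERIV: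
  assumes "t \<in> {s0<..<s1}"
  shows "(\<Phi> \<xi> \<eta> t has_real_derivative \<Phi>' \<xi> \<eta> t s) (at s)"
proof -
  have "(\<lambda>(t, x, v). L t x v) differentiable (at (t, xb t + s *\<^sub>R \<eta>, vb t + \<xi>))"
    by (rule C1_on_differentiable[OF L_C1]) (use arc_einterval[OF assms] in auto)
  from grad_x_DERIV[OF this] show ?thesis
    unfolding \<Phi>_def \<Phi>'_def inner_diff_left by (auto intro!: derivative_eq_intros)
qed

text \<open>Along the arc the point \<open>(t, xb t, vb t)\<close> moves with velocity
  \<open>(1, vb c, w)\<close>, where \<open>w\<close> is the second derivative of \<open>xb\<close>.
  The chain rule with the total derivatives of \<open>grad_x L\<close> at the shifted velocity
  (\<open>D\<close>) and at the original one (\<open>E\<close>) gives the time part; a displacement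
  \<open>s *\<^sub>R \<eta>\<close> affects only the shifted term and produces the Hessian.\<close>

lemma \<Phi>'_derivative:
  fixes \<xi> \<eta> :: "real^'n"
  assumes c: "c \<in> {s0<..<s1}"
  defines "A \<equiv> vector_derivative (\<lambda>t. Delta_Lx L t0 t1 xb t \<xi>) (at c)"
  shows "((\<lambda>t. Delta_Lx L t0 t1 xb t \<xi>) has_vector_derivative A) (at c)"
    and "((\<lambda>(t, s). \<Phi>' \<xi> \<eta> t s) has_derivative
           (\<lambda>(\<tau>, s). \<tau> * (A \<bullet> \<eta>) + s * (\<eta> \<bullet> (Lxx_bar L t0 t1 xb c \<xi> *v \<eta>)))) (at (c, 0))"
proof -
  obtain w where w: "(vb has_vector_derivative w) (at c)" using vb_derivative[OF c] by blast
  have Lx: "\<exists>D. ((\<lambda>(t, x, v). grad_x L t x v) has_derivative D) (at (c, xb c, vb c + \<zeta>))" for \<zeta>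
    using C1_on_differentiable[OF Lx_C1, of "(c, xb c, vb c + \<zeta>)"] arc_einterval[OF c]
    by (auto simp: differentiable_def)
  obtain D where D: "((\<lambda>(t, x, v). grad_x L t x v) has_derivative D) (at (c, xb c, vb c + \<xi>))"
    using Lx by blast
  obtain E where E: "((\<lambda>(t, x, v). grad_x L t x v) has_derivative E) (at (c, xb c, vb c))"
    using Lx[of 0] by auto
  have xb': "(xb has_derivative (\<lambda>\<tau>. \<tau> *\<^sub>R vb c)) (at c)"
    and vb': "(vb has_derivative (\<lambda>\<tau>. \<tau> *\<^sub>R w)) (at c)"
    using xb_derivative[OF c] w by (auto simp: has_vector_derivative_def)
  \<comment> \<open>Stated for arbitrary shift and direction, since it is used with
    \<open>\<xi>\<close>, \<open>\<eta>\<close> for \<open>D\<close> and with zero shift and zero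
    direction for \<open>E\<close>.\<close>
  have curve: "((\<lambda>p. (fst p, xb (fst p) + snd p *\<^sub>R \<eta>, vb (fst p) + \<zeta>)) has_derivative
      (\<lambda>p. (fst p, fst p *\<^sub>R vb c + snd p *\<^sub>R \<eta>, fst p *\<^sub>R w))) (at (c, 0))" for \<zeta> \<eta>
  proof -
    have fst: "(fst has_derivative fst) (at (c, 0::real))"
      by (rule bounded_linear_imp_has_derivative) (rule bounded_linear_fst)
    have "((\<lambda>p. xb (fst p)) has_derivative (\<lambda>p. fst p *\<^sub>R vb c)) (at (c, 0::real))"
      "((\<lambda>p. vb (fst p)) has_derivative (\<lambda>p. fst p *\<^sub>R w)) (at (c, 0::real))"
      using has_derivative_compose[OF fst, of xb] has_derivative_compose[OF fst, of vb] xb' vb' by auto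
    then show ?thesis by (auto intro!: derivative_eq_intros)
  qed
  have base: "((\<lambda>t. (t, xb t, vb t + \<zeta>)) has_derivative (\<lambda>\<tau>. (\<tau>, \<tau> *\<^sub>R vb c, \<tau> *\<^sub>R w))) (at c)" for \<zeta>
    using xb' vb' by (auto intro!: derivative_eq_intros)
  have linD: "linear D" and linE: "linear E" using D E by (auto intro: has_derivative_linear)
  have D1: "D (\<tau>, \<tau> *\<^sub>R vb c, \<tau> *\<^sub>R w) = \<tau> *\<^sub>R D (1, vb c, w)"
    and E1: "E (\<tau>, \<tau> *\<^sub>R vb c, \<tau> *\<^sub>R w) = \<tau> *\<^sub>R E (1, vb c, w)" for \<tau>
    using linear_cmul[OF linD, of \<tau> "(1, vb c, w)"] linear_cmul[OF linE, of \<tau> "(1, vb c, w)"] by simp_all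
  have "((\<lambda>t. grad_x L t (xb t) (vb t + \<xi>)) has_derivative (\<lambda>\<tau>. \<tau> *\<^sub>R D (1, vb c, w))) (at c)"
    "((\<lambda>t. grad_x L t (xb t) (vb t)) has_derivative (\<lambda>\<tau>. \<tau> *\<^sub>R E (1, vb c, w))) (at c)"
    using has_derivative_compose[OF base, of "\<lambda>(t, x, v). grad_x L t x v" D \<xi>] D
      has_derivative_compose[OF base, of "\<lambda>(t, x, v). grad_x L t x v" E 0] E D1 E1 by auto
  from has_derivative_diff[OF this]
  have "((\<lambda>t. Delta_Lx L t0 t1 xb t \<xi>) has_vector_derivative D (1, vb c, w) - E (1, vb c, w)) (at c)"
    by (simp add: has_vector_derivative_def Delta_Lx_def scaleR_diff_right)
  moreover from this have A: "A = D (1, vb c, w) - E (1, vb c, w)"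
    unfolding A_def by (rule vector_derivative_at)
  ultimately show "((\<lambda>t. Delta_Lx L t0 t1 xb t \<xi>) has_vector_derivative A) (at c)" by simp
  have D2: "D (\<tau>, \<tau> *\<^sub>R vb c + s *\<^sub>R \<eta>, \<tau> *\<^sub>R w) = \<tau> *\<^sub>R D (1, vb c, w) + s *\<^sub>R D (0, \<eta>, 0)" for \<tau> s
    using linear_add[OF linD, of "\<tau> *\<^sub>R (1, vb c, w)" "s *\<^sub>R (0, \<eta>, 0)"]
    by (simp add: linear_cmul[OF linD, symmetric])
  have "((\<lambda>p. grad_x L (fst p) (xb (fst p) + snd p *\<^sub>R \<eta>) (vb (fst p) + \<xi>)) has_derivative
      (\<lambda>p. fst p *\<^sub>R D (1, vb c, w) + snd p *\<^sub>R D (0, \<eta>, 0))) (at (c, 0))"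
    "((\<lambda>p. grad_x L (fst p) (xb (fst p)) (vb (fst p))) has_derivative (\<lambda>p. fst p *\<^sub>R E (1, vb c, w))) (at (c, 0::real))"
    using has_derivative_compose[OF curve, of "\<lambda>(t, x, v). grad_x L t x v" D \<eta> \<xi>] D
      has_derivative_compose[OF curve, of "\<lambda>(t, x, v). grad_x L t x v" E 0 0] E D2 E1 by auto
  from has_derivative_inner_left[OF has_derivative_diff[OF this], of \<eta>]
  have "((\<lambda>p. \<Phi>' \<xi> \<eta> (fst p) (snd p)) has_derivative
      (\<lambda>p. (fst p *\<^sub>R D (1, vb c, w) + snd p *\<^sub>R D (0, \<eta>, 0) - fst p *\<^sub>R E (1, vb c, w)) \<bullet> \<eta>)) (at (c, 0))"
    by (simp add: \<Phi>'_def)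
  moreover have "(fst p *\<^sub>R D (1, vb c, w) + snd p *\<^sub>R D (0, \<eta>, 0) - fst p *\<^sub>R E (1, vb c, w)) \<bullet> \<eta>
      = fst p * (A \<bullet> \<eta>) + snd p * (\<eta> \<bullet> (Lxx_bar L t0 t1 xb c \<xi> *v \<eta>))" for p
    unfolding A Lxx_bar_def hess_xx_apply[OF D] by (simp add: algebra_simps inner_commute)
  ultimately show "((\<lambda>(t, s). \<Phi>' \<xi> \<eta> t s) has_derivative
           (\<lambda>(\<tau>, s). \<tau> * (A \<bullet> \<eta>) + s * (\<eta> \<bullet> (Lxx_bar L t0 t1 xb c \<xi> *v \<eta>)))) (at (c, 0))"
    by (simp add: case_prod_beta')
qed

text \<open>An instance of \<open>second_order_expansion\<close> in which degeneration supplies the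
  vanishing at \<open>s = 0\<close>.\<close>

lemma degeneration_expansion:
  assumes c: "c \<in> {s0<..<s1}" and deg: "\<And>t. t \<in> {s0<..<s1} \<Longrightarrow> excess L t0 t1 xb t \<xi> = 0" and "e > 0"
  shows "\<exists>\<rho>>0. \<forall>\<tau> s. \<bar>\<tau>\<bar> < \<rho> \<longrightarrow> \<bar>s\<bar> < \<rho> \<longrightarrow>
    \<bar>\<Phi> \<xi> \<eta> (c + \<tau>) s - (s * (Delta_Lx L t0 t1 xb c \<xi> \<bullet> \<eta>)
       + \<tau> * s * (vector_derivative (\<lambda>t. Delta_Lx L t0 t1 xb t \<xi>) (at c) \<bullet> \<eta>)
       + s\<^sup>2 / 2 * (\<eta> \<bullet> (Lxx_bar L t0 t1 xb c \<xi> *v \<eta>)))\<bar> \<le> e * (\<bar>\<tau>\<bar> + \<bar>s\<bar>) * \<bar>s\<bar>"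
  unfolding \<Phi>'_0[symmetric]
  by (rule second_order_expansion[OF \<Phi>'_derivative(2)[OF c], of "{s0<..<s1}"])
    (use assms in \<open>auto simp: \<Phi>_0 intro: \<Phi>_DERIV\<close>)

section \<open>Increment of the functional along a tooth\<close>

lemma affine_piece_integral:
  fixes \<eta> :: "real^'n" and k d :: real
  assumes uw: "u \<le> w" "{u..w} \<subseteq> {s0<..<s1}"
  defines "B \<equiv> \<lambda>t. k * (t - d) * (grad_v L t (xb t) (vb t) \<bullet> \<eta>)"
  obtains I where "((\<lambda>t. \<Phi> (k *\<^sub>R \<eta>) \<eta> t (k * (t - d))) has_integral I) {u..w}"
    and "((\<lambda>t. L t (xb t + (k * (t - d)) *\<^sub>R \<eta>) (vb t + k *\<^sub>R \<eta>) - L t (xb t) (vb t))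
           has_integral I + (B w - B u)) {u..w}"
proof -
  \<comment> \<open>By the Euler equation and the product rule this is the derivative of
    \<open>B\<close>. It consists exactly of the linear terms subtracted in \<open>\<Phi>\<close> at
    slope \<open>k *\<^sub>R \<eta>\<close> and displacement \<open>k * (t - d)\<close>, so these
    integrate to a boundary term.\<close>
  let ?B' = "\<lambda>t. k * (grad_v L t (xb t) (vb t) \<bullet> \<eta>) + k * (t - d) * (grad_x L t (xb t) (vb t) \<bullet> \<eta>)"
  have cx: "continuous_on {u..w} xb" and cv: "continuous_on {u..w} vb"
    using xb_isCont vb_isCont uw(2) by (auto intro!: continuous_at_imp_continuous_on)
  have sub: "{u..w} \<subseteq> einterval a b" using uw(2) arc_einterval by blast
  \<comment> \<open>Continuity of the velocity gradient along the extremal is read off from its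
    differentiability in the Euler equation.\<close>
  have cgv: "continuous_on {u..w} (\<lambda>t. grad_v L t (xb t) (vb t))"
    using Euler uw(2) has_vector_derivative_continuous
    by (blast intro!: continuous_at_imp_continuous_on)
  have cL: "continuous_on {u..w} (\<lambda>t. L t (y t) (z t))" "continuous_on {u..w} (\<lambda>t. grad_x L t (y t) (z t))"
    if "continuous_on {u..w} y" "continuous_on {u..w} z" for y z
  proof -
    have c: "continuous_on {u..w} (\<lambda>t. (t, y t, z t))"
      by (intro continuous_on_Pair continuous_on_id that)
    have im: "(\<lambda>t. (t, y t, z t)) ` {u..w} \<subseteq> einterval a b \<times> UNIV \<times> UNIV" using sub by auto
    show "continuous_on {u..w} (\<lambda>t. L t (y t) (z t))" "continuous_on {u..w} (\<lambda>t. grad_x L t (y t) (z t))"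
      using continuous_on_compose2[OF C1_on_continuous_on[OF L_C1] c im]
        continuous_on_compose2[OF C1_on_continuous_on[OF Lx_C1] c im] by simp_all
  qed
  have "continuous_on {u..w} (\<lambda>t. \<Phi> (k *\<^sub>R \<eta>) \<eta> t (k * (t - d)))"
    unfolding \<Phi>_def by (intro continuous_intros cL cx cv cgv)
  then obtain I where I: "((\<lambda>t. \<Phi> (k *\<^sub>R \<eta>) \<eta> t (k * (t - d))) has_integral I) {u..w}"
    using integrable_continuous_interval by blast
  have "(B has_vector_derivative ?B' t) (at t within {u..w})" if "t \<in> {u..w}" for t
  proof -
    have "((\<lambda>s. grad_v L s (xb s) (vb s) \<bullet> \<eta>) has_real_derivative grad_x L t (xb t) (vb t) \<bullet> \<eta>) (at t)"
      using bounded_linear.has_vector_derivative[OF bounded_linear_inner_left Euler] that uw(2)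
      by (force simp: has_real_derivative_iff_has_vector_derivative)
    then have "(B has_real_derivative ?B' t) (at t)"
      unfolding B_def by (auto intro!: derivative_eq_intros simp: algebra_simps)
    then show ?thesis
      by (auto simp: has_real_derivative_iff_has_vector_derivative intro: has_vector_derivative_at_within)
  qed
  then have "(?B' has_integral B w - B u) {u..w}" by (rule fundamental_theorem_of_calculus[OF uw(1)])
  from has_integral_add[OF I this] I show ?thesis
    by (intro that) (auto simp: \<Phi>_def algebra_simps)
qed

text \<open>The tooth has total length \<open>h\<close>, of which the fraction \<open>l\<close> has
  slope \<open>\<eta>\<close>. The second slope \<open>\<xi> = l / (l - 1) *\<^sub>R \<eta>\<close>
  is the one with \<open>l *\<^sub>R \<eta> + (1 - l) *\<^sub>R \<xi> = 0\<close>, so that the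
  perturbation returns to zero.\<close>

definition competitor :: "real^'n \<Rightarrow> real \<Rightarrow> real \<Rightarrow> real \<Rightarrow> real \<Rightarrow> real^'n" where
  "competitor \<eta> l c h t = xb t + tooth c (c + l * h) (c + h) 1 (inverse (l - 1) * l) t *\<^sub>R \<eta>"

lemma tooth_matching: "l < 1 \<Longrightarrow> 1 * (c + l * h - c) = (inverse (l - 1) * l) * (c + l * h - (c + h))" for l c h :: real
proof -
  assume "l < 1"
  then have "inverse (l - 1) * (l - 1) = 1" by simp
  then have "l * h * (inverse (l - 1) * (l - 1)) = l * h" by simp
  then show ?thesis by (simp add: algebra_simps)
qed

context
  fixes \<eta> :: "real^'n" and l c h :: real
  assumes l: "0 < l" "l < 1" and h: "0 < h" and ch: "s0 < c" "c + h < s1"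
begin

lemma tooth_points: "t0 < c" "c < c + l * h" "c + l * h < c + h" "c + h < t1"
proof -
  show "c < c + l * h" "c + l * h < c + h" using l h by auto
  have "c \<in> {s0<..<s1}" "c + h \<in> {s0<..<s1}" using ch h by auto
  from this[THEN arc_interior] show "t0 < c" "c + h < t1" by auto
qed

lemma tooth_curve_KC1:
  "(\<lambda>t. tooth c (c + l * h) (c + h) 1 (inverse (l - 1) * l) t *\<^sub>R \<eta>) \<in> KC1 t0 t1"
  by (rule tooth_KC1(1)[OF tooth_points tooth_matching[OF l(2)]])

lemma competitor_admissible: "admissible t0 t1 x0 x1 (competitor \<eta> l c h)"
  unfolding admissible_def competitor_def
  using KC1_add(1)[OF t0_less_t1 xb_admissible(1) tooth_curve_KC1] tooth_points xb_admissible(2,3)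
  by (simp add: tooth_def)

lemma xdot_competitor:
  assumes "t \<in> {t0..t1} - (angular_points t0 t1 xb \<union> {c, c + l * h, c + h})"
  shows "xdot t0 t1 (competitor \<eta> l c h) t =
     vb t + tooth_slope c (c + l * h) (c + h) 1 (inverse (l - 1) * l) t *\<^sub>R \<eta>"
proof -
  let ?p = "\<lambda>t. tooth c (c + l * h) (c + h) 1 (inverse (l - 1) * l) t *\<^sub>R \<eta>"
  note tooth = tooth_KC1[OF tooth_points tooth_matching[OF l(2)], where \<eta> = \<eta>]
  have "t \<in> {t0..t1} - (angular_points t0 t1 xb \<union> angular_points t0 t1 ?p)"
    using assms tooth(2) by blast
  from KC1_add(2)[OF t0_less_t1 xb_admissible(1) tooth_curve_KC1 this]
  show ?thesis using tooth(3) assms unfolding competitor_def by auto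
qed

text \<open>The second piece falls from its value \<open>l * h\<close> at the break to zero, so the
  peak has height \<open>l * h\<close>, which is less than \<open>h\<close>.\<close>

lemma tooth_bound: "\<bar>tooth c (c + l * h) (c + h) 1 (inverse (l - 1) * l) t\<bar> \<le> h"
proof -
  let ?k = "inverse (l - 1) * l"
  have lh: "l * h < h" using tooth_points by simp
  have k: "?k \<le> 0" using l by (simp add: mult_nonpos_nonneg)
  have "?k * (t - (c + h)) \<le> l * h" if "c + l * h < t"
  proof -
    have "?k * (t - (c + h)) \<le> ?k * (c + l * h - (c + h))"
      using k that by (intro mult_left_mono_neg) auto
    also have "\<dots> = l * h" using tooth_matching[OF l(2), of c h] by (metis add_diff_cancel_left' mult_1)
    finally show ?thesis .
  qed
  moreover have "0 \<le> ?k * (t - (c + h))" if "t \<le> c + h"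
    using k that by (intro mult_nonpos_nonpos) auto
  moreover have "t - c \<le> h" if "t \<le> c + l * h" using lh that by linarith
  moreover have "l * h \<le> h" using lh by (rule less_imp_le)
  ultimately show ?thesis using h unfolding tooth_def
    by (smt (verit, best))
qed

lemma C_norm_competitor: "C_norm t0 t1 (\<lambda>t. competitor \<eta> l c h t - xb t) \<le> h * norm \<eta>"
  unfolding C_norm_def
  using t0_less_t1 tooth_bound
  by (intro cSUP_least) (auto simp: competitor_def intro: mult_right_mono)

lemma Linf_norm_competitor:
  "Linf_norm t0 t1 (\<lambda>t. xdot t0 t1 (competitor \<eta> l c h) t - vb t)
     \<le> ereal (max (norm \<eta>) (norm ((inverse (l - 1) * l) *\<^sub>R \<eta>)))"
proof -
  let ?N = "angular_points t0 t1 xb \<union> {c, c + l * h, c + h}"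
  \<comment> \<open>The upper bound on the essential supremum through \<open>esssup_I\<close>
    requires measurability, which follows from integrability of the derivatives.\<close>
  have meas: "xdot t0 t1 x \<in> borel_measurable (lebesgue_on {t0..t1})" if "x \<in> KC1 t0 t1" for x :: "real \<Rightarrow> real^'n"
    using integrable_bounded_continuous_off_finite[OF bounded_xdot[OF that] KC1_finite_angular[OF that]
        continuous_on_xdot_off_finite[OF order_refl]]
    by (rule integrable_imp_measurable)
  have "xdot t0 t1 (competitor \<eta> l c h) \<in> borel_measurable (lebesgue_on {t0..t1})"
    "vb \<in> borel_measurable (lebesgue_on {t0..t1})"
    using meas competitor_admissible xb_admissible(1) by (auto simp: admissible_def)
  then have m: "(\<lambda>t. ereal (norm (xdot t0 t1 (competitor \<eta> l c h) t - vb t))) \<in> borel_measurable (lebesgue_on {t0..t1})"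
    by (intro borel_measurable_ereal measurable_compose[OF borel_measurable_diff borel_measurable_norm])
  have "finite ?N" using KC1_finite_angular[OF xb_admissible(1)] by simp
  then have null: "?N \<inter> {t0..t1} \<in> null_sets (lebesgue_on {t0..t1})"
    by (subst null_sets_restrict_space)
      (auto simp flip: negligible_iff_null_sets intro: negligible_finite)
  have "norm (xdot t0 t1 (competitor \<eta> l c h) t - vb t) \<le> max (norm \<eta>) (norm ((inverse (l - 1) * l) *\<^sub>R \<eta>))"
    if "t \<in> {t0..t1} - ?N" for t
    unfolding xdot_competitor[OF that] by (auto simp: tooth_slope_def le_max_iff_disj)
  then have "AE t in lebesgue_on {t0..t1}. ereal (norm (xdot t0 t1 (competitor \<eta> l c h) t - vb t))
      \<le> ereal (max (norm \<eta>) (norm ((inverse (l - 1) * l) *\<^sub>R \<eta>)))"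
    by (intro AE_I'[OF null] subsetI) (metis (mono_tags, lifting) DiffI IntI ereal_less_eq(3) mem_Collect_eq space_lebesgue_on)
  then show ?thesis unfolding Linf_norm_def by (rule esssup_I[OF m])
qed

text \<open>The boundary terms of the two pieces vanish at \<open>c\<close> and
  \<open>c + h\<close>, where the tooth is zero, and cancel at the break because the two
  displacements match there. Only the integrals of \<open>\<Phi>\<close> survive.\<close>

lemma J_competitor:
  obtains I1 I2 where "((\<lambda>t. \<Phi> \<eta> \<eta> t (t - c)) has_integral I1) {c..c + l * h}"
    and "((\<lambda>t. \<Phi> ((inverse (l - 1) * l) *\<^sub>R \<eta>) \<eta> t ((inverse (l - 1) * l) * (t - (c + h)))) has_integral I2)
           {c + l * h..c + h}"
    and "J L t0 t1 (competitor \<eta> l c h) = J L t0 t1 xb + (I1 + I2)"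
proof -
  let ?k = "inverse (l - 1) * l" and ?m = "c + l * h" and ?d = "c + h"
  let ?B = "grad_v L ?m (xb ?m) (vb ?m) \<bullet> \<eta>"
  let ?f1 = "\<lambda>t. L t (xb t + (t - c) *\<^sub>R \<eta>) (vb t + \<eta>) - L t (xb t) (vb t)"
  let ?f2 = "\<lambda>t. L t (xb t + (?k * (t - ?d)) *\<^sub>R \<eta>) (vb t + ?k *\<^sub>R \<eta>) - L t (xb t) (vb t)"
  have pts: "c \<le> ?m" "?m \<le> ?d" by (rule less_imp_le[OF tooth_points(2)] less_imp_le[OF tooth_points(3)])+
  have "{c..?d} \<subseteq> {s0<..<s1}" using ch by auto
  then have sub: "{c..?m} \<subseteq> {s0<..<s1}" "{?m..?d} \<subseteq> {s0<..<s1}"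
    using pts by (meson atLeastatMost_subset_iff order_refl subset_trans)+
  obtain I1 where I1: "((\<lambda>t. \<Phi> \<eta> \<eta> t (t - c)) has_integral I1) {c..?m}"
    "(?f1 has_integral I1 + (?m - c) * ?B) {c..?m}"
    using affine_piece_integral[OF pts(1) sub(1), where k = 1 and d = c and \<eta> = \<eta>] by auto
  obtain I2 where I2: "((\<lambda>t. \<Phi> (?k *\<^sub>R \<eta>) \<eta> t (?k * (t - ?d))) has_integral I2) {?m..?d}"
    "(?f2 has_integral I2 + (0 - ?k * (?m - ?d) * ?B)) {?m..?d}"
    using affine_piece_integral[OF pts(2) sub(2), where k = ?k and d = ?d and \<eta> = \<eta>] by auto
  let ?f = "\<lambda>t. if t \<in> {c..?d} then (if t \<le> ?m then ?f1 t else ?f2 t) else 0"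
  have "((\<lambda>t. if t \<le> ?m then ?f1 t else ?f2 t) has_integral I1 + (?m - c) * ?B) {c..?m}"
    by (rule has_integral_eq[OF _ I1(2)]) auto
  \<comment> \<open>At the break the combined integrand takes the first branch, a discrepancy at a
    single point.\<close>
  moreover have "((\<lambda>t. if t \<le> ?m then ?f1 t else ?f2 t) has_integral I2 + (0 - ?k * (?m - ?d) * ?B)) {?m..?d}"
    by (rule has_integral_spike_finite[OF _ _ I2(2), of "{?m}"]) auto
  ultimately have "((\<lambda>t. if t \<le> ?m then ?f1 t else ?f2 t) has_integral
      (I1 + (?m - c) * ?B) + (I2 + (0 - ?k * (?m - ?d) * ?B))) {c..?d}"
    by (rule has_integral_combine[OF pts])
  moreover have "(?m - c) * ?B = ?k * (?m - ?d) * ?B"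
    using tooth_matching[OF l(2), of c h] by (simp only: mult_1)
  then have "(I1 + (?m - c) * ?B) + (I2 + (0 - ?k * (?m - ?d) * ?B)) = I1 + I2"
    by (simp only: add_diff_cancel diff_0)
  ultimately have "((\<lambda>t. if t \<le> ?m then ?f1 t else ?f2 t) has_integral I1 + I2) {c..?d}" by (simp only:)
  then have "(?f has_integral I1 + I2) {t0..t1}"
    using tooth_points by (subst has_integral_restrict) auto
  moreover let ?F = "\<lambda>x t. L t (x t) (xdot t0 t1 x t)"
  have "(?F xb has_integral J L t0 t1 xb) {t0..t1}"
    unfolding J_def
    by (intro integrable_integral Lagrangian_integrable[OF xb_admissible(1) interval_subset]
        C1_on_continuous_on[OF L_C1])
  ultimately have "((\<lambda>t. ?F xb t + ?f t) has_integral J L t0 t1 xb + (I1 + I2)) {t0..t1}"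
    by (rule has_integral_add[rotated])
  \<comment> \<open>The two integrands are compared only off the corners of \<open>xb\<close> and of
    the tooth, where the values of \<open>xdot\<close> are determined.\<close>
  then have "(?F (competitor \<eta> l c h) has_integral J L t0 t1 xb + (I1 + I2)) {t0..t1}"
  proof (rule has_integral_spike_finite[rotated 2])
    show "finite (angular_points t0 t1 xb \<union> {c, ?m, ?d})"
      using KC1_finite_angular[OF xb_admissible(1)] by simp
    fix t assume t: "t \<in> {t0..t1} - (angular_points t0 t1 xb \<union> {c, ?m, ?d})"
    show "?F (competitor \<eta> l c h) t = ?F xb t + ?f t"
      using t tooth_points
      by (auto simp: xdot_competitor[OF t] competitor_def tooth_def tooth_slope_def)
  qed
  then have "J L t0 t1 (competitor \<eta> l c h) = J L t0 t1 xb + (I1 + I2)"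
    unfolding J_def by (rule integral_unique)
  with I1(1) I2(1) show ?thesis by (rule that)
qed

end

section \<open>Necessary conditions from comparison with teeth\<close>

definition tooth_minimal :: "real^'n \<Rightarrow> real \<Rightarrow> bool" where
  "tooth_minimal \<eta> l \<longleftrightarrow>
     (\<forall>c\<in>{s0<..<s1}. \<exists>\<rho>>0. \<forall>h. 0 < h \<and> h < \<rho> \<longrightarrow> J L t0 t1 xb \<le> J L t0 t1 (competitor \<eta> l c h))"

text \<open>By \<open>J_competitor\<close> the increment of \<open>J\<close> is the sum of the two
  \<open>\<Phi>\<close>-integrals, so tooth-minimality gives the sign assumption of
  \<open>tooth_integrals_nonneg\<close>. The admissible lengths may depend on the point
  \<open>c\<close>.\<close>

lemma tooth_minimal_conditions:
  fixes \<eta> :: "real^'n" and l c :: real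
  defines "\<xi> \<equiv> (inverse (l - 1) * l) *\<^sub>R \<eta>"
  defines "A \<equiv> \<lambda>\<zeta>. vector_derivative (\<lambda>t. Delta_Lx L t0 t1 xb t \<zeta>) (at c) \<bullet> \<eta>"
  defines "Q \<equiv> \<lambda>\<zeta>. \<eta> \<bullet> (Lxx_bar L t0 t1 xb c \<zeta> *v \<eta>)"
  assumes l: "0 < l" "l < 1" and deg: "degeneration L t0 t1 xb s0 s1 \<eta> l"
    and min: "tooth_minimal \<eta> l" and c: "c \<in> {s0<..<s1}"
  shows "0 \<le> l * (Delta_Lx L t0 t1 xb c \<eta> \<bullet> \<eta>) + (1 - l) * (Delta_Lx L t0 t1 xb c \<xi> \<bullet> \<eta>)"
    and "l * (Delta_Lx L t0 t1 xb c \<eta> \<bullet> \<eta>) + (1 - l) * (Delta_Lx L t0 t1 xb c \<xi> \<bullet> \<eta>) = 0 \<Longrightarrow>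
      l * A \<eta> + (1 - l) * A \<xi> = 0 \<Longrightarrow> 0 \<le> l * Q \<eta> + (1 - l) * Q \<xi> - A \<eta>"
proof -
  have deg': "excess L t0 t1 xb t \<eta> = 0" "excess L t0 t1 xb t \<xi> = 0" if "t \<in> {s0<..<s1}" for t
    using deg that by (auto simp: degeneration_def \<xi>_def)
  obtain \<rho> where \<rho>: "\<rho> > 0" "\<And>h. 0 < h \<Longrightarrow> h < \<rho> \<Longrightarrow> J L t0 t1 xb \<le> J L t0 t1 (competitor \<eta> l c h)"
    using min c unfolding tooth_minimal_def by blast
  have nonneg: "\<exists>\<rho>>0. \<forall>h. 0 < h \<and> h < \<rho> \<longrightarrow>
      (\<exists>I1 I2. ((\<lambda>t. \<Phi> \<eta> \<eta> t (t - c)) has_integral I1) {c..c + l * h} \<and>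
         ((\<lambda>t. \<Phi> \<xi> \<eta> t ((inverse (l - 1) * l) * (t - (c + h)))) has_integral I2) {c + l * h..c + h} \<and> 0 \<le> I1 + I2)"
  \<comment> \<open>The bound \<open>s1 - c\<close> keeps the whole tooth inside the arc.\<close>
  proof (rule exI[of _ "min \<rho> (s1 - c)"], intro conjI allI impI)
    fix h assume h: "0 < h \<and> h < min \<rho> (s1 - c)"
    then have "0 < h" "s0 < c" "c + h < s1" using c by auto
    from J_competitor[OF l this, of \<eta>, folded \<xi>_def] obtain I1 I2 where
      "((\<lambda>t. \<Phi> \<eta> \<eta> t (t - c)) has_integral I1) {c..c + l * h}"
      "((\<lambda>t. \<Phi> \<xi> \<eta> t ((inverse (l - 1) * l) * (t - (c + h)))) has_integral I2) {c + l * h..c + h}"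
      "J L t0 t1 (competitor \<eta> l c h) = J L t0 t1 xb + (I1 + I2)" .
    moreover from this(3) have "0 \<le> I1 + I2" using \<rho>(2)[of h] h by simp
    ultimately
    show "\<exists>I1 I2. ((\<lambda>t. \<Phi> \<eta> \<eta> t (t - c)) has_integral I1) {c..c + l * h} \<and>
         ((\<lambda>t. \<Phi> \<xi> \<eta> t ((inverse (l - 1) * l) * (t - (c + h)))) has_integral I2) {c + l * h..c + h} \<and> 0 \<le> I1 + I2"
      by blast
  qed (use \<rho>(1) c in auto)
  note main = tooth_integrals_nonneg[OF l degeneration_expansion[OF c deg'(1)]
      degeneration_expansion[OF c deg'(2)] nonneg]
  show "0 \<le> l * (Delta_Lx L t0 t1 xb c \<eta> \<bullet> \<eta>) + (1 - l) * (Delta_Lx L t0 t1 xb c \<xi> \<bullet> \<eta>)"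
    by (rule main(1))
  show "l * (Delta_Lx L t0 t1 xb c \<eta> \<bullet> \<eta>) + (1 - l) * (Delta_Lx L t0 t1 xb c \<xi> \<bullet> \<eta>) = 0 \<Longrightarrow>
      l * A \<eta> + (1 - l) * A \<xi> = 0 \<Longrightarrow> 0 \<le> l * Q \<eta> + (1 - l) * Q \<xi> - A \<eta>"
    unfolding A_def Q_def by (rule main(2))
qed

text \<open>Passing from \<open>(\<eta>, l)\<close> to \<open>(\<xi>, 1 - l)\<close> is an
  involution: the second slope belonging to \<open>\<xi>\<close> is again
  \<open>\<eta>\<close>.\<close>

lemma conjugate_slope: "0 < l \<Longrightarrow> l < 1 \<Longrightarrow> (inverse (1 - l - 1) * (1 - l)) *\<^sub>R (inverse (l - 1) * l) *\<^sub>R \<eta> = \<eta>"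
  for l :: real and \<eta> :: "real^'n"
proof -
  assume "0 < l" "l < 1"
  then have "(inverse (1 - l - 1) * (1 - l)) * (inverse (l - 1) * l) = 1" by (simp add: field_simps)
  then show ?thesis by simp
qed

text \<open>Exchanging the two slopes, that is \<open>(\<eta>, l)\<close> with \<open>(\<xi>, 1 - l)\<close>, reverses the sign of the quadratic
  term, which therefore vanishes at every point of the arc; its derivative vanishes too, which
  eliminates the derivative of \<^const>\<open>Delta_Lx\<close> at \<open>\<xi>\<close> from the cubic term.\<close>

lemma condition_C_if_tooth_minimal:
  fixes \<eta> :: "real^'n" and l :: real
  defines "\<xi> \<equiv> (inverse (l - 1) * l) *\<^sub>R \<eta>"
  assumes l: "0 < l" "l < 1" and deg: "degeneration L t0 t1 xb s0 s1 \<eta> l"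
    and min: "tooth_minimal \<eta> l" "tooth_minimal \<xi> (1 - l)"
  shows "condition_C L t0 t1 xb s0 s1 \<eta> l"
  unfolding condition_C_def \<xi>_def[symmetric]
proof
  fix c assume c: "c \<in> {s0<..<s1}"
  define Z where "Z t = l * (Delta_Lx L t0 t1 xb t \<eta> \<bullet> \<eta>) + (1 - l) * (Delta_Lx L t0 t1 xb t \<xi> \<bullet> \<eta>)" for t
  let ?k = "inverse (l - 1) * l"
  have deg2: "degeneration L t0 t1 xb s0 s1 \<xi> (1 - l)"
    using deg conjugate_slope[OF l] by (auto simp: degeneration_def \<xi>_def)
  have Z0: "Z t = 0" if t: "t \<in> {s0<..<s1}" for t
  proof -
    have "0 \<le> Z t" using tooth_minimal_conditions(1)[OF l deg min(1) t] by (simp add: Z_def \<xi>_def)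
    moreover have "0 \<le> (1 - l) * (Delta_Lx L t0 t1 xb t \<xi> \<bullet> \<xi>) + (1 - (1 - l)) * (Delta_Lx L t0 t1 xb t \<eta> \<bullet> \<xi>)"
      using tooth_minimal_conditions(1)[OF _ _ deg2 min(2) t] l conjugate_slope[OF l] unfolding \<xi>_def by simp
    \<comment> \<open>Since \<open>\<xi> = ?k *\<^sub>R \<eta>\<close>, the exchanged condition is
      the original expression multiplied by the negative number \<open>?k\<close>, which gives the
      opposite inequality for \<open>Z t\<close>.\<close>
    then have "0 \<le> ?k * Z t" by (simp add: Z_def \<xi>_def algebra_simps)
    moreover have "?k < 0" using l by (simp add: mult_neg_pos)
    ultimately show ?thesis using mult_neg_pos[of ?k "Z t"] by linarith
  qed
  let ?A = "\<lambda>\<zeta>. vector_derivative (\<lambda>t. Delta_Lx L t0 t1 xb t \<zeta>) (at c) \<bullet> \<eta>"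
  have "((\<lambda>t. Delta_Lx L t0 t1 xb t \<zeta> \<bullet> \<eta>) has_real_derivative ?A \<zeta>) (at c)" for \<zeta>
    using bounded_linear.has_vector_derivative[OF bounded_linear_inner_left \<Phi>'_derivative(1)[OF c]]
    by (simp add: has_real_derivative_iff_has_vector_derivative)
  then have "(Z has_real_derivative l * ?A \<eta> + (1 - l) * ?A \<xi>) (at c)"
    unfolding Z_def by (auto intro!: derivative_eq_intros)
  moreover have "(Z has_real_derivative 0) (at c)"
    by (rule has_field_derivative_transform_within_open[of "\<lambda>_. 0" _ _ "{s0<..<s1}"])
      (use c Z0 in auto)
  ultimately have "l * ?A \<eta> + (1 - l) * ?A \<xi> = 0" by (rule DERIV_unique)
  then have "0 \<le> l * (\<eta> \<bullet> (Lxx_bar L t0 t1 xb c \<eta> *v \<eta>)) + (1 - l) * (\<eta> \<bullet> (Lxx_bar L t0 t1 xb c \<xi> *v \<eta>)) - ?A \<eta>"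
    using tooth_minimal_conditions(2)[OF l deg min(1) c] Z0[OF c] by (simp add: Z_def \<xi>_def)
  then show "0 \<le> \<eta> \<bullet> ((l *\<^sub>R Lxx_bar L t0 t1 xb c \<eta> + (1 - l) *\<^sub>R Lxx_bar L t0 t1 xb c \<xi>) *v \<eta>)
      - vector_derivative (\<lambda>s. Delta_Lx L t0 t1 xb s \<eta>) (at c) \<bullet> \<eta>"
    by (simp add: matrix_vector_mult_add_rdistrib scaleR_matrix_vector_assoc[symmetric] inner_add_right)
qed

section \<open>Tooth-minimality of strong and weak local minima\<close>

lemma C_norm_competitor_small:
  assumes "0 < l" "l < 1" "c \<in> {s0<..<s1}" "\<delta> > 0"
  obtains \<rho> where "\<rho> > 0" "\<And>h. 0 < h \<Longrightarrow> h < \<rho> \<Longrightarrow>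
     c + h < s1 \<and> C_norm t0 t1 (\<lambda>t. competitor \<eta> l c h t - xb t) \<le> \<delta>"
proof -
  \<comment> \<open>The displacement is at most \<open>h * norm \<eta>\<close>; adding one in the
    denominator covers \<open>\<eta> = 0\<close>.\<close>
  let ?\<rho> = "min (s1 - c) (\<delta> / (norm \<eta> + 1))"
  have pos: "norm \<eta> + 1 > 0" by (simp add: add_nonneg_pos)
  show thesis
  proof (rule that[of ?\<rho>])
    show "?\<rho> > 0" using assms pos by simp
    fix h assume h: "0 < h" "h < ?\<rho>"
    have "h * (norm \<eta> + 1) < \<delta>" using h pos by (simp add: pos_less_divide_eq)
    then have "h * norm \<eta> \<le> \<delta>" using h by (simp add: distrib_left)
    then show "c + h < s1 \<and> C_norm t0 t1 (\<lambda>t. competitor \<eta> l c h t - xb t) \<le> \<delta>"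
      using C_norm_competitor[of l h c \<eta>] assms h by simp
  qed
qed

text \<open>Only the displacement has to be small, and it shrinks with \<open>h\<close>; slopes of
  any size are allowed.\<close>

lemma strong_local_min_tooth_minimal:
  assumes "strong_local_min L t0 t1 x0 x1 xb" "0 < l" "l < 1"
  shows "tooth_minimal \<eta> l"
  unfolding tooth_minimal_def
proof
  fix c assume c: "c \<in> {s0<..<s1}"
  obtain \<delta> where \<delta>: "\<delta> > 0" "\<And>x. admissible t0 t1 x0 x1 x \<Longrightarrow> C_norm t0 t1 (\<lambda>t. x t - xb t) \<le> \<delta> \<Longrightarrow>
      J L t0 t1 xb \<le> J L t0 t1 x"
    using assms(1) unfolding strong_local_min_def by blast
  obtain \<rho> where \<rho>: "\<rho> > 0" "\<And>h. 0 < h \<Longrightarrow> h < \<rho> \<Longrightarrow>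
     c + h < s1 \<and> C_norm t0 t1 (\<lambda>t. competitor \<eta> l c h t - xb t) \<le> \<delta>"
    using C_norm_competitor_small[OF assms(2,3) c \<delta>(1)] by metis
  show "\<exists>\<rho>>0. \<forall>h. 0 < h \<and> h < \<rho> \<longrightarrow> J L t0 t1 xb \<le> J L t0 t1 (competitor \<eta> l c h)"
    using \<rho> c assms(2,3) by (auto intro!: exI[of _ \<rho>] \<delta>(2) competitor_admissible)
qed

text \<open>The velocity perturbation does not shrink with \<open>h\<close>, so both slopes must lie
  within the radius of minimality. That radius serves as \<open>\<delta>\<close>, uniformly in
  \<open>\<eta>\<close> and \<open>l\<close>, while a small \<open>h\<close> controls the
  displacement.\<close>

lemma weak_local_min_tooth_minimal:
  assumes "weak_local_min L t0 t1 x0 x1 xb"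
  obtains \<delta> where "\<delta> > 0" "\<And>\<eta> l. 0 < l \<Longrightarrow> l < 1 \<Longrightarrow> norm \<eta> \<le> \<delta> \<Longrightarrow>
     norm ((inverse (l - 1) * l) *\<^sub>R \<eta>) \<le> \<delta> \<Longrightarrow> tooth_minimal \<eta> l"
proof -
  obtain \<delta> where \<delta>: "\<delta> > 0" "\<And>x. admissible t0 t1 x0 x1 x \<Longrightarrow>
      max (ereal (C_norm t0 t1 (\<lambda>t. x t - xb t))) (Linf_norm t0 t1 (\<lambda>t. xdot t0 t1 x t - vb t)) \<le> ereal \<delta> \<Longrightarrow>
      J L t0 t1 xb \<le> J L t0 t1 x"
    using assms unfolding weak_local_min_def by blast
  show thesis
  proof (rule that[OF \<delta>(1)])
    fix \<eta> :: "real^'n" and l :: real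
    assume l: "0 < l" "l < 1" and \<eta>: "norm \<eta> \<le> \<delta>" "norm ((inverse (l - 1) * l) *\<^sub>R \<eta>) \<le> \<delta>"
    show "tooth_minimal \<eta> l"
      unfolding tooth_minimal_def
    proof
      fix c assume c: "c \<in> {s0<..<s1}"
      obtain \<rho> where \<rho>: "\<rho> > 0" "\<And>h. 0 < h \<Longrightarrow> h < \<rho> \<Longrightarrow>
         c + h < s1 \<and> C_norm t0 t1 (\<lambda>t. competitor \<eta> l c h t - xb t) \<le> \<delta>"
        using C_norm_competitor_small[OF l c \<delta>(1)] by metis
      have "J L t0 t1 xb \<le> J L t0 t1 (competitor \<eta> l c h)" if h: "0 < h" "h < \<rho>" for h
      proof (rule \<delta>(2))
        have ch: "s0 < c" "c + h < s1" using c \<rho>(2)[OF h] by auto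
        show "admissible t0 t1 x0 x1 (competitor \<eta> l c h)"
          by (rule competitor_admissible[OF l h(1) ch])
        have "Linf_norm t0 t1 (\<lambda>t. xdot t0 t1 (competitor \<eta> l c h) t - vb t) \<le> ereal \<delta>"
          using Linf_norm_competitor[OF l h(1) ch, of \<eta>] \<eta> by (elim order_trans) simp
        then show "max (ereal (C_norm t0 t1 (\<lambda>t. competitor \<eta> l c h t - xb t)))
            (Linf_norm t0 t1 (\<lambda>t. xdot t0 t1 (competitor \<eta> l c h) t - vb t)) \<le> ereal \<delta>"
          using \<rho>(2)[OF h] by simp
      qed
      then show "\<exists>\<rho>>0. \<forall>h. 0 < h \<and> h < \<rho> \<longrightarrow> J L t0 t1 xb \<le> J L t0 t1 (competitor \<eta> l c h)"
        using \<rho>(1) by blast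
    qed
  qed
qed

end

theorem theorem4p2:
  fixes L :: "('n::finite) lagrangian"
    and a b :: ereal
    and t0 t1 s0 s1 :: real
    and x0 x1 :: "real^'n"
    and xb :: "real \<Rightarrow> real^'n"
  assumes "t0 < t1" and "{t0..t1} \<subseteq> einterval a b"
    and "C1_on (\<lambda>(t, x, v). L t x v) (einterval a b \<times> UNIV \<times> UNIV)"
    and "C1_on (\<lambda>(t, x, v). grad_x L t x v) (einterval a b \<times> UNIV \<times> UNIV)"
    and "extremal L t0 t1 x0 x1 xb"
    and "s0 < s1" and "{s0<..<s1} \<subseteq> {t0..t1}"
    and "xb C1_differentiable_on {s0<..<s1}"
    and "xdot t0 t1 xb C1_differentiable_on {s0<..<s1}"
  shows "(strong_local_min L t0 t1 x0 x1 xb \<longrightarrow>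
            (\<forall>\<eta> l. \<eta> \<noteq> 0 \<and> l \<in> {0<..<1} \<and> degeneration L t0 t1 xb s0 s1 \<eta> l
               \<longrightarrow> condition_C L t0 t1 xb s0 s1 \<eta> l))
       \<and> (weak_local_min L t0 t1 x0 x1 xb \<longrightarrow>
            (\<exists>\<delta>>0. \<forall>\<eta> l. \<eta> \<in> cball 0 \<delta> \<and> (inverse (l - 1) * l) *\<^sub>R \<eta> \<in> cball 0 \<delta> \<and>
                 l \<in> {0<..<1} \<and> degeneration L t0 t1 xb s0 s1 \<eta> l
               \<longrightarrow> condition_C L t0 t1 xb s0 s1 \<eta> l))"
proof -
  interpret extremal_arc L a b t0 t1 s0 s1 x0 x1 xb
    using assms(1-5,7-9) by unfold_locales
  have swap: "0 < 1 - l" "1 - l < 1" if "l \<in> {0<..<1}" for l :: real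
    using that by auto
  show ?thesis
  proof (intro conjI impI)
    assume min: "strong_local_min L t0 t1 x0 x1 xb"
    show "\<forall>\<eta> l. \<eta> \<noteq> 0 \<and> l \<in> {0<..<1} \<and> degeneration L t0 t1 xb s0 s1 \<eta> l
        \<longrightarrow> condition_C L t0 t1 xb s0 s1 \<eta> l"
      using swap by (auto intro!: condition_C_if_tooth_minimal strong_local_min_tooth_minimal[OF min])
  next
    assume min: "weak_local_min L t0 t1 x0 x1 xb"
    obtain \<delta> where \<delta>: "\<delta> > 0" "\<And>\<eta> l. 0 < l \<Longrightarrow> l < 1 \<Longrightarrow> norm \<eta> \<le> \<delta> \<Longrightarrow>
        norm ((inverse (l - 1) * l) *\<^sub>R \<eta>) \<le> \<delta> \<Longrightarrow> tooth_minimal \<eta> l"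
      using weak_local_min_tooth_minimal[OF min] by blast
    have "condition_C L t0 t1 xb s0 s1 \<eta> l"
      if \<eta>: "\<eta> \<in> cball 0 \<delta>" "(inverse (l - 1) * l) *\<^sub>R \<eta> \<in> cball 0 \<delta>" and l: "l \<in> {0<..<1}"
        and deg: "degeneration L t0 t1 xb s0 s1 \<eta> l" for \<eta> l
    proof (rule condition_C_if_tooth_minimal)
      show "0 < l" "l < 1" using l by auto
      then show "tooth_minimal \<eta> l" using \<eta> by (intro \<delta>(2)) auto
      \<comment> \<open>For the exchanged pair the two ball conditions trade places, because the
        second slope belonging to \<open>\<xi>\<close> is \<open>\<eta>\<close>; one radius thus
        serves both teeth.\<close>
      show "tooth_minimal ((inverse (l - 1) * l) *\<^sub>R \<eta>) (1 - l)"
        using \<eta> swap[OF l] conjugate_slope[OF \<open>0 < l\<close> \<open>l < 1\<close>, of \<eta>]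
        by (intro \<delta>(2)) (simp_all only: mem_cball_0)
    qed (rule deg)
    then show "\<exists>\<delta>>0. \<forall>\<eta> l. \<eta> \<in> cball 0 \<delta> \<and> (inverse (l - 1) * l) *\<^sub>R \<eta> \<in> cball 0 \<delta> \<and>
        l \<in> {0<..<1} \<and> degeneration L t0 t1 xb s0 s1 \<eta> l
        \<longrightarrow> condition_C L t0 t1 xb s0 s1 \<eta> l"
      using \<delta>(1) by blast
  qed
qed

end
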